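(* Consider the linear regression model $\boldsymbol{Y}=\boldsymbol{X}\boldsymbol{\beta}+\boldsymbol{\varepsilon}$, where $\boldsymbol{Y}$ is a random $n$-vector, $\boldsymbol{X}$ is a known $n\times p$ matrix with linearly independent columns ($n>p$), $\boldsymbol{\beta}\in\mathbb{R}^p$ is unknown and $\boldsymbol{\varepsilon}\sim N(\boldsymbol{0},\sigma^2\boldsymbol{I}_n)$ with $\sigma^2>0$ unknown. Let $\theta=\boldsymbol{a}^T\boldsymbol{\beta}$ for a given $\boldsymbol{a}\neq\boldsymbol{0}$, and $\boldsymbol{\tau}=\boldsymbol{C}^T\boldsymbol{\beta}-\boldsymbol{t}$, where $\boldsymbol{C}$ is a given $p\times s$ matrix ($s<p$) with linearly independent columns, $\boldsymbol{t}$ a given $s$-vector, and $\boldsymbol{a}$ is not in the column span of $\boldsymbol{C}$. Let $\hat{\boldsymbol{\beta}}$ be the least squares estimator, $\hat\Sigma^2=(\boldsymbol{Y}-\boldsymbol{X}\hat{\boldsymbol{\beta}})^T(\boldsymbol{Y}-\boldsymbol{X}\hat{\boldsymbol{\beta}})/(n-p)$, $\hat\Theta=\boldsymbol{a}^T\hat{\boldsymbol{\beta}}$, $\hat{\boldsymbol{\tau}}=\boldsymbol{C}^T\hat{\boldsymbol{\beta}}-\boldsymbol{t}$, and assume $E\big((\hat{\boldsymbol{\tau}}-\boldsymbol{\tau})(\hat\Theta-\theta)\big)=\boldsymbol{0}$. Let $m=n-p$, $v_{11}=\boldsymbol{a}^T(\boldsymbol{X}^T\boldsymbol{X})^{-1}\boldsymbol{a}$,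 $\boldsymbol{V}_{22}=\boldsymbol{C}^T(\boldsymbol{X}^T\boldsymbol{X})^{-1}\boldsymbol{C}$, and let $t(m)$ satisfy $P(-t(m)\le T\le t(m))=1-\alpha$ for $T\sim t_m$. Let $F=\big(\hat{\boldsymbol{\tau}}^T\boldsymbol{V}_{22}^{-1}\hat{\boldsymbol{\tau}}/s\big)/\hat\Sigma^2$ and, for a function $d:[0,\infty)\to(0,\infty)$ that is continuous and satisfies $d(x)=t(m)$ for all $x\ge k$ (where $k>0$ is specified), let $$J(d)=\Big[\hat\Theta-\sqrt{v_{11}}\,\hat\Sigma\,d(\sqrt{F}),\ \hat\Theta+\sqrt{v_{11}}\,\hat\Sigma\,d(\sqrt{F})\Big].$$ Let $\boldsymbol{\gamma}=(1/\sigma)\boldsymbol{V}_{22}^{-1/2}\boldsymbol{\tau}$, $Q=(1/\sigma^2)\hat{\boldsymbol{\tau}}^T\boldsymbol{V}_{22}^{-1}\hat{\boldsymbol{\tau}}$, $V=\sqrt{Q/s}$, $W=\hat\Sigma/\sigma$; let $f_V(\cdot;\|\boldsymbol{\gamma}\|)$ and $f_W$ be the probability density functions of $V$ and $W$ (so $Q$ is noncentral $\chi^2$ with $s$ degrees of freedom and noncentrality parameter $\|\boldsymbol{\gamma}\|^2$, and $W\sim\sqrt{\chi^2_m/m}$), and let $\Phi$ be the $N(0,1)$ distribution function. Then: (a) the coverage probability $P(\theta\in J(d))$ equals $$1-\alpha+2\int_0^k\int_0^\infty\big(\Phi(w\,d(x))-\Phi(w\,t(m))\big)\,f_V(xw;\|\boldsymbol{\gamma}\|)\,w\,f_W(w)\,dw\,dx,$$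 and hence, for given $d$, depends on the parameters only through $\|\boldsymbol{\gamma}\|$; (b) the scaled expected length of $J(d)$, i.e. $E(\text{length of }J(d))/E(\text{length of }I)$ where $I=[\hat\Theta-t(m)\sqrt{v_{11}}\hat\Sigma,\ \hat\Theta+t(m)\sqrt{v_{11}}\hat\Sigma]$, equals $$1+\frac{1}{t(m)E(W)}\int_0^\infty\int_0^k\big(d(x)-t(m)\big)\,f_V(xw;\|\boldsymbol{\gamma}\|)\,dx\,w^2\,f_W(w)\,dw,$$ and hence, for given $d$, depends on the parameters only through $\|\boldsymbol{\gamma}\|$.
   Context: $\|\boldsymbol{\gamma}\|=\sqrt{\boldsymbol{\gamma}^T\boldsymbol{\gamma}}$; $\boldsymbol{V}_{22}^{-1/2}$ is the inverse of the symmetric positive definite square root of $\boldsymbol{V}_{22}$; $0<\alpha<1$. *)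

theory Defs
  imports "HOL-Probability.Probability"
begin

definition Phi :: "real \<Rightarrow> real" where
  "Phi x = measure (density lborel (\<lambda>t. ennreal (std_normal_density t))) {..x}"

definition chi2_density :: "real \<Rightarrow> real \<Rightarrow> real" where
  "chi2_density k q = (if q > 0 then q powr (k/2 - 1) * exp (- q/2) / (2 powr (k/2) * Gamma (k/2)) else 0)"

text \<open>Density of the noncentral chi-squared distribution with k degrees of freedom
  and noncentrality parameter lam (Poisson mixture of central chi-squared densities).\<close>
definition ncchi2_density :: "real \<Rightarrow> real \<Rightarrow> real \<Rightarrow> real" where
  "ncchi2_density k lam q =
     (\<Sum>j. exp (- lam/2) * (lam/2) ^ j / fact j * chi2_density (k + 2 * real j) q)"

definition student_t_density :: "real \<Rightarrow> real \<Rightarrow> real" where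
  "student_t_density m x = Gamma ((m+1)/2) / (sqrt (m * pi) * Gamma (m/2)) * (1 + x\<^sup>2/m) powr (-(m+1)/2)"

text \<open>f_V(v; g): density of V = sqrt(Q/s) where Q is noncentral chi-squared with s degrees
  of freedom and noncentrality parameter g^2.\<close>
definition fV :: "real \<Rightarrow> real \<Rightarrow> real \<Rightarrow> real" where
  "fV s g v = (if v > 0 then ncchi2_density s (g\<^sup>2) (s * v\<^sup>2) * 2 * s * v else 0)"

text \<open>f_W(w): density of W = sqrt(chi^2_m / m).\<close>
definition fW :: "real \<Rightarrow> real \<Rightarrow> real" where
  "fW m w = (if w > 0 then chi2_density m (m * w\<^sup>2) * 2 * m * w else 0)"

definition pd_sqrt :: "real^'n^'n \<Rightarrow> real^'n^'n" where
  "pd_sqrt A = (THE R. transpose R = R \<and> (\<forall>x. x \<noteq> 0 \<longrightarrow> x \<bullet> (R *v x) > 0) \<and> R ** R = A)"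

text \<open>Least squares estimator (X has full column rank).\<close>
definition lse :: "real^'p^'n \<Rightarrow> real^'n \<Rightarrow> real^'p" where
  "lse X y = matrix_inv (transpose X ** X) *v (transpose X *v y)"

end

theory Submission
  imports Defs
begin

text \<open>Put \<open>P = X (X\<^sup>T X)\<^sup>-\<^sup>1\<close>. The errors of \<open>\<Theta>\<close>-hat and \<open>\<tau>\<close>-hat are linear forms in \<open>\<epsilon>\<close>: along the
  vector \<open>P a\<close> and along the image of \<open>P C\<close>. Both lie in the column space of \<open>X\<close>, and the
  vanishing covariance makes them orthogonal. In an orthonormal basis adapted to \<open>P a\<close>, the image of
  \<open>P C\<close> and the orthogonal complement of the column space, the coordinates of \<open>\<epsilon> / \<sigma>\<close> are again
  independent standard normal. So the standardised error \<open>Z\<close> of \<open>\<Theta>\<close>-hat, \<open>Q\<close> and \<open>W\<close> are independent,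
  and turning the basis so that the mean of \<open>\<tau>\<close>-hat points along one axis shows that \<open>Q\<close> is
  noncentral chi-squared with noncentrality \<open>\<parallel>\<gamma>\<parallel>\<^sup>2\<close>. Since \<open>\<surd>F = V / W\<close>, coverage is the
  event \<open>\<bar>Z\<bar> \<le> W d(V / W)\<close>; compare with the event \<open>\<bar>Z\<bar> \<le> W t(m)\<close>, integrate out \<open>Z\<close>, and
  substitute \<open>v = x w\<close> in the joint density of \<open>(V, W)\<close>: the difference vanishes for \<open>x \<ge> k\<close>.\<close>

text \<open>The noncentral chi-squared density is given as a Poisson mixture of central densities,
  so this particular series has to be matched. Since a single coordinate carries the mean, only one
  shifted square is compared with the series directly: with one degree of freedom the mixture
  becomes the power series of cosh(v g). The other coordinates are central and enter by convolution,
  which acts on the mixture term by term and reduces to a Beta integral. The vector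
  \<open>\<gamma>\<close> is given through \<open>pd_sqrt\<close>, a definite description. Its norm
  can be evaluated only after existence and uniqueness of the root are proved; this is the purpose
  of the spectral theorem for symmetric matrices. The level 1 - \<open>\<alpha>\<close> is specified
  through the Student density, so the probability of \<open>\<bar>Z\<bar> \<le> W t(m)\<close> must
  be reduced to an integral of that density. The same computation at the point 0 shows that E(W) is
  finite and positive, as the quotient in (b) requires. Division by zero yields 0, so outcomes with
  \<open>W = 0\<close> need no separate treatment: there the argument of \<open>d\<close> is 0, on
  both sides of every identity for \<open>F\<close>.\<close>

section \<open>Orthogonal invariance of the Gaussian law\<close>

text \<open>The image measure \<open>N\<close> is translation invariant, so Fubini gives
  \<open>N A * lborel B = N (- B) * lborel A\<close>; take for \<open>B\<close> the unit ball, on which both measures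
  agree. (The change of variables theorems of the library need a well-ordered index type.)\<close>

lemma lborel_distr_orthogonal:
  fixes f :: "'a::euclidean_space \<Rightarrow> 'a"
  assumes f: "orthogonal_transformation f"
  shows "distr lborel borel f = lborel"
proof -
  have lin: "linear f" using f by (rule orthogonal_transformation_linear)
  have [measurable]: "f \<in> borel_measurable borel"
    using lin by (intro borel_measurable_continuous_onI linear_continuous_on) (simp add: linear_conv_bounded_linear)
  define N where "N = distr lborel borel f"
  have sN[measurable_cong]: "sets N = sets borel" by (simp add: N_def)
  have spN: "space N = UNIV" by (simp add: N_def)
  have N_ball: "emeasure N (ball 0 r) = emeasure lborel (ball (0::'a) r)" for r
  proof -
    have "f -` ball 0 r = ball 0 r"
      using f by (auto simp: orthogonal_transformation_norm)
    then show ?thesis by (simp add: N_def emeasure_distr)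
  qed
  have transl: "emeasure N ((\<lambda>x. x + v) -` A) = emeasure N A" if [measurable]: "A \<in> sets borel" for A v
  proof -
    obtain u where u: "f u = v"
      using orthogonal_transformation_surj[OF f] by (metis surjD)
    have "emeasure N ((\<lambda>x. x + v) -` A) = emeasure lborel (f -` ((\<lambda>x. x + v) -` A))"
      using measurable_sets[OF borel_measurable_add[OF measurable_ident_sets[OF refl] borel_measurable_const] that, of v]
      by (simp add: N_def emeasure_distr)
    also have "f -` ((\<lambda>x. x + v) -` A) = (+) u -` (f -` A)"
      using u by (auto simp: linear_add[OF lin] add.commute)
    also have "emeasure lborel \<dots> = emeasure (distr lborel borel ((+) u)) (f -` A)"
      using measurable_sets[OF \<open>f \<in> borel_measurable borel\<close> that] by (simp add: emeasure_distr)
    also have "\<dots> = emeasure N A" by (simp add: lborel_distr_plus N_def emeasure_distr)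
    finally show ?thesis .
  qed
  have transl_nn: "(\<integral>\<^sup>+x. g (x + v) \<partial>N) = (\<integral>\<^sup>+x. g x \<partial>N)" if [measurable]: "g \<in> borel_measurable borel" for g :: "'a \<Rightarrow> ennreal" and v
  proof -
    have "distr N borel (\<lambda>x. x + v) = N"
      by (rule measure_eqI) (auto simp: sN emeasure_distr spN transl)
    then have "(\<integral>\<^sup>+x. g x \<partial>N) = (\<integral>\<^sup>+x. g x \<partial>distr N borel (\<lambda>x. x + v))" by simp
    also have "\<dots> = (\<integral>\<^sup>+x. g (x + v) \<partial>N)"
      by (subst nn_integral_distr) auto
    finally show ?thesis ..
  qed
  have transl_lb: "(\<integral>\<^sup>+x. g (x + v) \<partial>lborel) = (\<integral>\<^sup>+x. g x \<partial>lborel)" if [measurable]: "g \<in> borel_measurable borel" for g :: "'a \<Rightarrow> ennreal" and v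
  proof -
    have "(\<integral>\<^sup>+x. g x \<partial>lborel) = (\<integral>\<^sup>+x. g x \<partial>distr lborel borel ((+) v))" by (simp add: lborel_distr_plus)
    also have "\<dots> = (\<integral>\<^sup>+x. g (x + v) \<partial>lborel)"
      by (subst nn_integral_distr) (auto simp: add.commute)
    finally show ?thesis ..
  qed
  have "sigma_finite_measure N"
  proof
    show "\<exists>A. countable A \<and> A \<subseteq> sets N \<and> \<Union> A = space N \<and> (\<forall>a\<in>A. emeasure N a \<noteq> \<infinity>)"
    proof (intro exI[of _ "range (\<lambda>n::nat. ball (0::'a) (real n))"] conjI ballI)
      show "\<Union> (range (\<lambda>n. ball 0 (real n))) = space N"
        by (auto simp: spN reals_Archimedean2)
      fix B :: "'a set" assume "B \<in> range (\<lambda>n::nat. ball 0 (real n))"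
      then show "emeasure N B \<noteq> \<infinity>"
        using emeasure_lborel_ball_finite[of 0] by (auto simp: N_ball less_top)
    qed (auto simp: sN)
  qed
  then interpret P: pair_sigma_finite N lborel
    by (simp add: pair_sigma_finite_def lborel.sigma_finite_measure_axioms)
  let ?B = "ball (0::'a) 1"
  define b :: "'a \<Rightarrow> ennreal" where "b = indicator ?B"
  have b[measurable]: "b \<in> borel_measurable borel" by (simp add: b_def borel_measurable_indicator)
  have Nb: "(\<integral>\<^sup>+x. b x \<partial>N) = emeasure lborel ?B" "(\<integral>\<^sup>+x. b x \<partial>lborel) = emeasure lborel ?B"
    by (simp_all add: b_def sN N_ball)
  have "emeasure N A = emeasure lborel A" if A: "A \<in> sets borel" for A
  proof -
    define c :: "'a \<Rightarrow> ennreal" where "c = indicator A"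
    have c[measurable]: "c \<in> borel_measurable borel" using A by (simp add: c_def borel_measurable_indicator)
    have Nc: "(\<integral>\<^sup>+x. c x \<partial>N) = emeasure N A" "(\<integral>\<^sup>+x. c x \<partial>lborel) = emeasure lborel A"
      using A by (simp_all add: c_def sN)
    have "emeasure N A * emeasure lborel ?B = (\<integral>\<^sup>+x. (\<integral>\<^sup>+y. c x * b (y - x) \<partial>lborel) \<partial>N)"
      using transl_lb[OF b, of "- x" for x]
      by (simp add: nn_integral_cmult nn_integral_multc Nc Nb)
    also have "\<dots> = (\<integral>\<^sup>+y. (\<integral>\<^sup>+x. c x * b (y - x) \<partial>N) \<partial>lborel)"
      by (rule P.Fubini'[symmetric]) measurable
    also have "\<dots> = (\<integral>\<^sup>+y. (\<integral>\<^sup>+x. c (x + y) * b (- x) \<partial>N) \<partial>lborel)"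
    proof (rule nn_integral_cong)
      fix y
      have "(\<integral>\<^sup>+x. c (x + y) * b (y - (x + y)) \<partial>N) = (\<integral>\<^sup>+x. c x * b (y - x) \<partial>N)"
        by (rule transl_nn) measurable
      then show "(\<integral>\<^sup>+x. c x * b (y - x) \<partial>N) = (\<integral>\<^sup>+x. c (x + y) * b (- x) \<partial>N)"
        by simp
    qed
    also have "\<dots> = (\<integral>\<^sup>+x. (\<integral>\<^sup>+y. c (x + y) * b (- x) \<partial>lborel) \<partial>N)"
      by (rule P.Fubini') measurable
    also have "\<dots> = (\<integral>\<^sup>+x. emeasure lborel A * b (- x) \<partial>N)"
      using transl_lb[OF c] by (simp add: nn_integral_multc add.commute Nc)
    also have "\<dots> = (\<integral>\<^sup>+x. emeasure lborel A * b x \<partial>N)"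
      by (intro nn_integral_cong) (auto simp: indicator_def b_def)
    also have "\<dots> = emeasure lborel A * emeasure lborel ?B"
      by (simp add: nn_integral_cmult Nb)
    finally have *: "emeasure N A * emeasure lborel ?B = emeasure lborel A * emeasure lborel ?B" .
    have "emeasure lborel ?B \<noteq> 0"
      using emeasure_lborel_ball_finite[of "0::'a" 1] content_ball_pos[of 1 "0::'a"]
      by (auto simp: measure_def)
    moreover have "emeasure lborel ?B \<noteq> \<infinity>"
      using emeasure_lborel_ball_finite[of "0::'a" 1] by simp
    ultimately show ?thesis
      using * by (metis ennreal_mult_cancel_left infinity_ennreal_def mult.commute)
  qed
  then show ?thesis unfolding N_def[symmetric]
    by (intro measure_eqI) (simp_all add: sN)
qed

lemma prod_Basis_vec:
  fixes g :: "real^'n \<Rightarrow> 'b::comm_monoid_mult"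
  shows "(\<Prod>b\<in>Basis. g b) = (\<Prod>i\<in>UNIV. g (axis i 1))"
proof -
  have B: "(Basis :: (real^'n) set) = range (\<lambda>i. axis i 1)"
    by (auto simp: Basis_vec_def)
  have inj: "inj (\<lambda>i::'n. axis i (1::real))"
    by (auto simp: inj_on_def axis_eq_axis)
  show ?thesis unfolding B by (subst prod.reindex[OF inj]) (simp add: comp_def)
qed

text \<open>The joint density depends on \<open>x\<close> only through its norm; this is what makes
  the Gaussian law invariant under orthogonal maps.\<close>

lemma prod_normal_density:
  fixes x :: "real^'n"
  shows "(\<Prod>i\<in>UNIV. normal_density 0 \<sigma> (x $ i)) = (1 / sqrt (2 * pi * \<sigma>\<^sup>2)) ^ CARD('n) * exp (- (norm x)\<^sup>2 / (2 * \<sigma>\<^sup>2))"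
proof -
  have "(\<Prod>i\<in>UNIV. normal_density 0 \<sigma> (x $ i)) =
    (1 / sqrt (2 * pi * \<sigma>\<^sup>2)) ^ CARD('n) * exp (\<Sum>i\<in>UNIV. - (x $ i)\<^sup>2 / (2 * \<sigma>\<^sup>2))"
    by (simp add: normal_density_def prod.distrib exp_sum prod_dividef power_divide)
  also have "(\<Sum>i\<in>UNIV. - (x $ i)\<^sup>2 / (2 * \<sigma>\<^sup>2)) = - (norm x)\<^sup>2 / (2 * \<sigma>\<^sup>2)"
    by (simp add: norm_vec_def L2_set_def sum_nonneg sum_negf sum_divide_distrib)
  finally show ?thesis .
qed

context prob_space
begin

text \<open>On an open box, independence factorises the probability and the product form factorises
  the integral of the density. Open boxes are stable under intersection and generate the Borel sets,
  so agreement on them suffices.\<close>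

lemma distr_iid_normal:
  fixes \<epsilon> :: "'a \<Rightarrow> real^'n"
  assumes ind: "indep_vars (\<lambda>_. borel) (\<lambda>i \<omega>. \<epsilon> \<omega> $ i) UNIV"
    and dist: "\<And>i. distributed M lborel (\<lambda>\<omega>. \<epsilon> \<omega> $ i) (\<lambda>x. ennreal (normal_density 0 \<sigma> x))"
  shows "\<epsilon> \<in> borel_measurable M"
    and "distr M borel \<epsilon> = density lborel (\<lambda>x. \<Prod>i\<in>UNIV. ennreal (normal_density 0 \<sigma> (x $ i)))"
proof -
  have rv[measurable]: "(\<lambda>\<omega>. \<epsilon> \<omega> $ i) \<in> borel_measurable M" for i
    using distributed_measurable[OF dist[of i]] by simp
  have "(\<lambda>\<omega>. \<chi> i. \<epsilon> \<omega> $ i) \<in> borel_measurable M"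
    by (subst borel_measurable_euclidean_space) (auto simp: Basis_vec_def inner_axis)
  then show [measurable]: "\<epsilon> \<in> borel_measurable M" by simp
  let ?g = "\<lambda>x::real^'n. \<Prod>i\<in>UNIV. ennreal (normal_density 0 \<sigma> (x $ i))"
  let ?D = "density lborel ?g"
  show "distr M borel \<epsilon> = ?D"
  proof (rule measure_eqI_generator_eq)
    let ?E = "range (\<lambda>(a, b). box a b::(real^'n) set)"
    show "Int_stable ?E"
      by (auto simp: Int_stable_def box_Int_box)
    show "?E \<subseteq> Pow UNIV" "sets (distr M borel \<epsilon>) = sigma_sets UNIV ?E" "sets ?D = sigma_sets UNIV ?E"
      by (simp_all add: borel_eq_box)
    let ?A = "\<lambda>n::nat. box (- (real n *\<^sub>R One)) (real n *\<^sub>R One) :: (real^'n) set"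
    show "range ?A \<subseteq> ?E" "(\<Union>i. ?A i) = UNIV"
      unfolding UN_box_eq_UNIV by auto
    show "emeasure (distr M borel \<epsilon>) (?A i) \<noteq> \<infinity>" for i
      by (simp add: emeasure_distr)
    fix B assume "B \<in> ?E"
    then obtain l u where B: "B = box l u" by auto
    have "emeasure (distr M borel \<epsilon>) B = emeasure M (\<Inter>i\<in>UNIV. (\<lambda>\<omega>. \<epsilon> \<omega> $ i) -` {l $ i<..<u $ i} \<inter> space M)"
      unfolding B by (subst emeasure_distr) (auto simp: mem_box_cart intro!: arg_cong[where f="emeasure M"])
    also have "\<dots> = (\<Prod>i\<in>UNIV. emeasure M ((\<lambda>\<omega>. \<epsilon> \<omega> $ i) -` {l $ i<..<u $ i} \<inter> space M))"
      using indep_varsD_finite[OF ind, of "\<lambda>i. {l $ i<..<u $ i}"]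
      by (simp add: emeasure_eq_measure prod_ennreal)
    also have "\<dots> = (\<Prod>i\<in>UNIV. \<integral>\<^sup>+x. ennreal (normal_density 0 \<sigma> x) * indicator {l $ i<..<u $ i} x \<partial>lborel)"
      by (intro prod.cong refl distributed_emeasure[OF dist]) simp
    also have "\<dots> = (\<Prod>b\<in>Basis. \<integral>\<^sup>+x. ennreal (normal_density 0 \<sigma> x) * indicator {l \<bullet> b<..<u \<bullet> b} x \<partial>lborel)"
      by (simp add: prod_Basis_vec inner_axis)
    also have "\<dots> = (\<integral>\<^sup>+x. (\<Prod>b\<in>Basis. ennreal (normal_density 0 \<sigma> (x \<bullet> b)) * indicator {l \<bullet> b<..<u \<bullet> b} (x \<bullet> b)) \<partial>lborel)"
      by (intro nn_integral_lborel_prod[symmetric]) auto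
    also have "\<dots> = (\<integral>\<^sup>+x. ?g x * indicator B x \<partial>lborel)"
      by (intro nn_integral_cong)
         (auto simp: prod.distrib prod_Basis_vec inner_axis B mem_box_cart indicator_def not_less prod_zero_iff)
    also have "\<dots> = emeasure ?D B"
      by (subst emeasure_density) (auto simp: B)
    finally show "emeasure (distr M borel \<epsilon>) B = emeasure ?D B" .
  qed
qed

text \<open>Both ingredients of the law are invariant under \<open>f\<close>: Lebesgue measure by
  \<open>lborel_distr_orthogonal\<close>, the density because \<open>f\<close> preserves
  norms.\<close>

lemma distr_orthogonal_iid_normal:
  fixes \<epsilon> :: "'a \<Rightarrow> real^'n"
  assumes ind: "indep_vars (\<lambda>_. borel) (\<lambda>i \<omega>. \<epsilon> \<omega> $ i) UNIV"
    and dist: "\<And>i. distributed M lborel (\<lambda>\<omega>. \<epsilon> \<omega> $ i) (\<lambda>x. ennreal (normal_density 0 \<sigma> x))"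
    and f: "orthogonal_transformation f"
  shows "distr M borel (\<lambda>\<omega>. f (\<epsilon> \<omega>)) = distr M borel \<epsilon>"
proof -
  have [measurable]: "\<epsilon> \<in> borel_measurable M"
    by (rule distr_iid_normal(1)[OF ind dist])
  have lin: "linear f" using f by (rule orthogonal_transformation_linear)
  have [measurable]: "f \<in> borel_measurable borel"
    using lin by (intro borel_measurable_continuous_onI linear_continuous_on) (simp add: linear_conv_bounded_linear)
  let ?g = "\<lambda>x::real^'n. \<Prod>i\<in>UNIV. ennreal (normal_density 0 \<sigma> (x $ i))"
  have g: "?g (f x) = ?g x" for x
    using orthogonal_transformation_norm[OF f, of x] by (simp add: prod_ennreal prod_normal_density)
  have "distr M borel (\<lambda>\<omega>. f (\<epsilon> \<omega>)) = distr (distr M borel \<epsilon>) borel f"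
    by (subst distr_distr) (auto simp: comp_def)
  also have "\<dots> = distr (density lborel (\<lambda>x. ?g (f x))) borel f"
    unfolding g by (simp only: distr_iid_normal(2)[OF ind dist])
  also have "\<dots> = density (distr lborel borel f) ?g"
    by (rule density_distr[symmetric]) auto
  also have "\<dots> = distr M borel \<epsilon>"
    by (simp only: lborel_distr_orthogonal[OF f] distr_iid_normal(2)[OF ind dist])
  finally show ?thesis .
qed

text \<open>There is one vector \<open>h i\<close> per index, so these vectors are the rows of an
  orthogonal matrix. Independence and marginals are both read off from the single equality of joint
  laws.\<close>

lemma iid_normal_orthonormal_coordinates:
  fixes \<epsilon> :: "'a \<Rightarrow> real^'n" and h :: "'n \<Rightarrow> real^'n"
  assumes ind: "indep_vars (\<lambda>_. borel) (\<lambda>i \<omega>. \<epsilon> \<omega> $ i) UNIV"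
    and dist: "\<And>i. distributed M lborel (\<lambda>\<omega>. \<epsilon> \<omega> $ i) (\<lambda>x. ennreal (normal_density 0 \<sigma> x))"
    and h: "\<And>i. norm (h i) = 1" "\<And>i j. i \<noteq> j \<Longrightarrow> orthogonal (h i) (h j)"
  shows "indep_vars (\<lambda>_. borel) (\<lambda>i \<omega>. h i \<bullet> \<epsilon> \<omega>) UNIV"
    and "distributed M lborel (\<lambda>\<omega>. h i \<bullet> \<epsilon> \<omega>) (\<lambda>x. ennreal (normal_density 0 \<sigma> x))"
proof -
  define A where "A = (\<chi> i. h i)"
  define f where "f = (\<lambda>x. A *v x)"
  have "orthogonal_matrix A"
    unfolding orthogonal_matrix_orthonormal_rows using h by (simp add: A_def row_def)
  then have f: "orthogonal_transformation f"
    unfolding orthogonal_transformation_matrix f_def by simp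
  have fh: "f x $ i = h i \<bullet> x" for x i
    by (simp add: f_def A_def matrix_vector_mult_def inner_vec_def)
  have [measurable]: "\<epsilon> \<in> borel_measurable M"
    by (rule distr_iid_normal(1)[OF ind dist])
  have lin: "linear f" using f by (rule orthogonal_transformation_linear)
  have [measurable]: "f \<in> borel_measurable borel"
    using lin by (intro borel_measurable_continuous_onI linear_continuous_on) (simp add: linear_conv_bounded_linear)
  have law: "distr M borel (\<lambda>\<omega>. f (\<epsilon> \<omega>)) = distr M borel \<epsilon>"
    by (rule distr_orthogonal_iid_normal[OF ind dist f])
  have fc: "distr M N (\<lambda>\<omega>. c (f (\<epsilon> \<omega>))) = distr M N (\<lambda>\<omega>. c (\<epsilon> \<omega>))" if [measurable]: "c \<in> measurable borel N"
    for c :: "real^'n \<Rightarrow> 'c" and N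
  proof -
    have "distr M N (\<lambda>\<omega>. c (f (\<epsilon> \<omega>))) = distr (distr M borel (\<lambda>\<omega>. f (\<epsilon> \<omega>))) N c"
      by (subst distr_distr) (auto simp: comp_def)
    also have "\<dots> = distr M N (\<lambda>\<omega>. c (\<epsilon> \<omega>))"
      unfolding law by (subst distr_distr) (auto simp: comp_def)
    finally show ?thesis .
  qed
  have comp: "(\<lambda>x::real^'n. x $ i) \<in> borel_measurable borel" for i
    by (intro borel_measurable_continuous_onI continuous_intros)
  have *: "distr M borel (\<lambda>\<omega>. h i \<bullet> \<epsilon> \<omega>) = distr M borel (\<lambda>\<omega>. \<epsilon> \<omega> $ i)" for i
    using fc[OF comp] by (simp add: fh)
  show "indep_vars (\<lambda>_. borel) (\<lambda>i \<omega>. h i \<bullet> \<epsilon> \<omega>) UNIV"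
  proof (subst indep_vars_iff_distr_eq_PiM')
    have "(\<lambda>x::real^'n. \<lambda>i\<in>UNIV. x $ i) \<in> measurable borel (\<Pi>\<^sub>M i\<in>UNIV. borel)"
      using comp by (intro measurable_restrict) auto
    then have "distr M (\<Pi>\<^sub>M i\<in>UNIV. borel) (\<lambda>\<omega>. \<lambda>i\<in>UNIV. h i \<bullet> \<epsilon> \<omega>) = distr M (\<Pi>\<^sub>M i\<in>UNIV. borel) (\<lambda>\<omega>. \<lambda>i\<in>UNIV. \<epsilon> \<omega> $ i)"
      using fc[of "\<lambda>x::real^'n. \<lambda>i\<in>UNIV. x $ i" "\<Pi>\<^sub>M i\<in>UNIV. borel"] by (simp add: fh)
    also have "\<dots> = (\<Pi>\<^sub>M i\<in>UNIV. distr M borel (\<lambda>\<omega>. \<epsilon> \<omega> $ i))"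
      using ind distributed_measurable[OF dist] by (subst (asm) indep_vars_iff_distr_eq_PiM') auto
    also have "\<dots> = (\<Pi>\<^sub>M i\<in>UNIV. distr M borel (\<lambda>\<omega>. h i \<bullet> \<epsilon> \<omega>))"
      by (simp add: *)
    finally show "distr M (\<Pi>\<^sub>M i\<in>UNIV. borel) (\<lambda>\<omega>. \<lambda>i\<in>UNIV. h i \<bullet> \<epsilon> \<omega>) = (\<Pi>\<^sub>M i\<in>UNIV. distr M borel (\<lambda>\<omega>. h i \<bullet> \<epsilon> \<omega>))" .
  qed auto
  \<comment> \<open>An image measure sees only the sigma-algebra of its target, and that of
    \<open>lborel\<close> is the Borel one.\<close>
  have "distr M lborel (\<lambda>\<omega>. h i \<bullet> \<epsilon> \<omega>) = distr M lborel (\<lambda>\<omega>. \<epsilon> \<omega> $ i)"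
    using * by (simp cong: distr_cong add: distr_def)
  then show "distributed M lborel (\<lambda>\<omega>. h i \<bullet> \<epsilon> \<omega>) (\<lambda>x. ennreal (normal_density 0 \<sigma> x))"
    using dist[of i] by (simp add: distributed_def)
qed

end

section \<open>Positive definite square roots\<close>

text \<open>A maximiser of the quadratic form on the unit sphere is an eigenvector.\<close>

lemma selfadjoint_eigenvector:
  fixes f :: "'a::euclidean_space \<Rightarrow> 'a"
  assumes lin: "linear f" and sa: "\<And>x y. f x \<bullet> y = x \<bullet> f y"
    and S: "subspace S" "f ` S \<subseteq> S" "S \<noteq> {0}"
  obtains x c where "x \<in> S" "norm x = 1" "f x = c *\<^sub>R x"
proof -
  have cont: "continuous_on A f" for A
    using lin by (intro linear_continuous_on) (simp add: linear_conv_bounded_linear)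
  have cl: "closed S" using S(1) by (rule closed_subspace)
  have "compact (sphere 0 1 \<inter> S)"
    using cl by (intro compact_Int_closed) auto
  moreover have "sphere 0 1 \<inter> S \<noteq> {}"
  proof -
    obtain y where y: "y \<in> S" "y \<noteq> 0"
      using S(3) subspace_0[OF S(1)] by blast
    then have "(1 / norm y) *\<^sub>R y \<in> sphere 0 1 \<inter> S"
      using S(1) by (auto simp: subspace_scale)
    then show ?thesis by blast
  qed
  moreover have "continuous_on (sphere 0 1 \<inter> S) (\<lambda>x. x \<bullet> f x)"
    by (intro continuous_intros cont)
  ultimately obtain x where x: "x \<in> sphere 0 1 \<inter> S"
    and max: "\<And>y. y \<in> sphere 0 1 \<inter> S \<Longrightarrow> y \<bullet> f y \<le> x \<bullet> f x"
    using continuous_attains_sup by metis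
  define c where "c = x \<bullet> f x"
  have le: "y \<bullet> f y \<le> c * (norm y)\<^sup>2" if "y \<in> S" for y
  proof (cases "y = 0")
    case False
    have "(1 / norm y) *\<^sub>R y \<in> sphere 0 1 \<inter> S"
      using False that S(1) by (auto simp: subspace_scale)
    from max[OF this] have "(y \<bullet> f y) / (norm y)\<^sup>2 \<le> c"
      by (simp add: linear_cmul[OF lin] c_def power2_eq_square field_simps)
    then show ?thesis using False by (simp add: field_simps)
  qed (simp add: linear_0[OF lin])
  define w where "w = f x - c *\<^sub>R x"
  have xS: "x \<in> S" "norm x = 1" and xx: "x \<bullet> x = 1"
    using x by (auto simp: dot_square_norm)
  have wS: "w \<in> S"
    using xS S by (auto simp: w_def intro!: subspace_diff subspace_scale)
  have wx: "w \<bullet> x = 0"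
    using xx by (simp add: w_def inner_diff_left inner_diff_right c_def inner_commute)
  have fx: "f x = w + c *\<^sub>R x" by (simp add: w_def)
  define e where "e = c * (w \<bullet> w) - w \<bullet> f w"
  \<comment> \<open>Moving from the maximiser \<open>x\<close> in direction \<open>w\<close> changes
    the form by a term linear in \<open>t\<close> and one quadratic in \<open>t\<close>; maximality
    bounds the first by the second.\<close>
  have key: "2 * t * (w \<bullet> w) \<le> t\<^sup>2 * e" for t
  proof -
    have "x + t *\<^sub>R w \<in> S" using xS wS S(1) by (intro subspace_add subspace_scale)
    from le[OF this] have "(x + t *\<^sub>R w) \<bullet> f (x + t *\<^sub>R w) \<le> c * ((x + t *\<^sub>R w) \<bullet> (x + t *\<^sub>R w))"
      by (simp add: dot_square_norm)
    moreover have "x \<bullet> f w = w \<bullet> w"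
      using sa[of x w] wx xx by (simp add: fx inner_add_left inner_add_right inner_commute)
    moreover have "w \<bullet> f x = w \<bullet> w"
      using wx by (simp add: fx inner_add_right)
    moreover have "x \<bullet> f x = c" by (simp add: c_def)
    ultimately show ?thesis
      using wx xx by (simp add: linear_add[OF lin] linear_cmul[OF lin] inner_add_left inner_add_right
          inner_commute[of x w] e_def power2_eq_square algebra_simps)
  qed
  have "w \<bullet> w = 0"
  proof (rule ccontr)
    assume "w \<bullet> w \<noteq> 0"
    then have pos: "w \<bullet> w > 0" by (simp add: inner_gt_zero_iff)
    \<comment> \<open>A small positive \<open>t\<close> lets the linear term win. The summand 1
      keeps the denominator positive when \<open>e = 0\<close>.\<close>
    define t where "t = (w \<bullet> w) / (\<bar>e\<bar> + 1)"
    have t: "t > 0" using pos by (simp add: t_def)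
    have "2 * (w \<bullet> w) \<le> t * e"
      using key[of t] t by (simp add: power2_eq_square mult.assoc)
    also have "\<dots> \<le> t * (\<bar>e\<bar> + 1)" using t by (intro mult_left_mono) auto
    also have "\<dots> = w \<bullet> w" by (simp add: t_def)
    finally show False using pos by simp
  qed
  then have "f x = c *\<^sub>R x" by (simp add: w_def)
  then show thesis using that xS by blast
qed

text \<open>Induction on the dimension: inside \<open>S\<close>, the complement of an eigenvector is
  again invariant because \<open>f\<close> is self-adjoint. The claim is made for all invariant
  subspaces so that the induction hypothesis applies to this complement.\<close>

lemma selfadjoint_eigenbasis_subspace:
  fixes f :: "'a::euclidean_space \<Rightarrow> 'a"
  assumes lin: "linear f" and sa: "\<And>x y. f x \<bullet> y = x \<bullet> f y"
    and "subspace S" "f ` S \<subseteq> S"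
  shows "\<exists>B ev. B \<subseteq> S \<and> pairwise orthogonal B \<and> (\<forall>b\<in>B. norm b = 1 \<and> f b = ev b *\<^sub>R b) \<and> span B = S"
  using assms(3,4)
proof (induction "dim S" arbitrary: S)
  case 0
  then have "S = {0}" using dim_eq_0[of S] subspace_0[of S] by auto
  then show ?case by (intro exI[of _ "{}"]) simp
next
  case (Suc d)
  have "S \<noteq> {0}" using Suc.hyps(2) by auto
  with Suc.prems obtain x c where x: "x \<in> S" "norm x = 1" "f x = c *\<^sub>R x"
    using selfadjoint_eigenvector[OF lin sa] by metis
  have xx: "x \<bullet> x = 1" using x(2) by (simp add: dot_square_norm)
  \<comment> \<open>This shape of the complement fits the dimension count by
    \<open>dim_subspace_orthogonal_to_vectors\<close>; the simpler description follows.\<close>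
  define S' where "S' = {y \<in> S. \<forall>z\<in>span {x}. orthogonal z y}"
  have S': "S' = {y \<in> S. orthogonal x y}"
    unfolding S'_def by (auto simp: span_singleton orthogonal_def)
  have sub: "subspace S'"
    using Suc.prems(1) unfolding S' by (auto simp: subspace_def orthogonal_def inner_add_right)
  have inv: "f ` S' \<subseteq> S'"
    using Suc.prems(2) sa[of x, symmetric] by (auto simp: S' orthogonal_def x(3))
  have "dim S' + dim (span {x}) = dim S"
    unfolding S'_def using Suc.prems(1) x(1)
    by (intro dim_subspace_orthogonal_to_vectors) (auto simp: span_minimal)
  moreover have "dim (span {x}) = 1"
    using x(2) by (subst dim_span) (simp add: dim_singleton, force)
  ultimately have "d = dim S'" using Suc.hyps(2) by simp
  from Suc.hyps(1)[OF this sub inv] obtain B ev where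
    B: "B \<subseteq> S'" "pairwise orthogonal B" "\<forall>b\<in>B. norm b = 1 \<and> f b = ev b *\<^sub>R b" "span B = S'"
    by blast
  have "span (insert x B) = S"
  proof
    show "span (insert x B) \<subseteq> S"
      using B(1) x(1) Suc.prems(1) by (intro span_minimal) (auto simp: S')
    show "S \<subseteq> span (insert x B)"
    proof
      fix y assume y: "y \<in> S"
      have "y - (x \<bullet> y) *\<^sub>R x \<in> S'"
        using y x(1) Suc.prems(1) xx
        by (auto simp: S' orthogonal_def inner_diff_right intro: subspace_diff subspace_scale)
      then show "y \<in> span (insert x B)"
        using B(4) by (auto simp: span_breakdown_eq)
    qed
  qed
  moreover have "pairwise orthogonal (insert x B)"
    using B(1,2) by (auto simp: pairwise_insert S' orthogonal_commute)
  \<comment> \<open>Hence overriding \<open>ev\<close> at \<open>x\<close> leaves the eigenvalues on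
    \<open>B\<close> untouched.\<close>
  moreover have "x \<notin> B" using B(1) xx by (auto simp: S' orthogonal_def)
  ultimately show ?case
    using x B(1,3) by (intro exI[of _ "insert x B"] exI[of _ "ev(x := c)"]) (auto simp: S')
qed

lemma orthonormal_expansion:
  fixes B :: "'a::euclidean_space set"
  assumes "pairwise orthogonal B" "\<And>b. b \<in> B \<Longrightarrow> norm b = 1" "x \<in> span B"
  shows "x = (\<Sum>b\<in>B. (b \<bullet> x) *\<^sub>R b)"
proof -
  have "0 \<notin> B" using assms(2) by (metis norm_zero zero_neq_one)
  then have "independent B"
    using assms(1) by (intro pairwise_orthogonal_independent)
  then have fin: "finite B" by (rule independent_imp_finite)
  obtain u where u: "x = (\<Sum>b\<in>B. u b *\<^sub>R b)"
    using assms(3) span_finite[OF fin] by auto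
  have "b \<bullet> x = u b" if "b \<in> B" for b
  proof -
    have "b \<bullet> x = (\<Sum>c\<in>B. u c * (b \<bullet> c))" by (simp add: u inner_sum_right)
    also have "\<dots> = (\<Sum>c\<in>B. if c = b then u b else 0)"
      using that assms(1,2) by (intro sum.cong) (auto simp: pairwise_def orthogonal_def dot_square_norm)
    finally show ?thesis using fin that by simp
  qed
  then show ?thesis using u by simp
qed

lemma inner_symmetric_matrix:
  fixes A :: "real^'n^'n"
  assumes "transpose A = A"
  shows "(A *v x) \<bullet> y = x \<bullet> (A *v y)"
  using assms by (metis dot_lmul_matrix transpose_matrix_vector)

lemma symmetric_matrix_eigenbasis:
  fixes A :: "real^'n^'n"
  assumes "transpose A = A"
  obtains B ev where "pairwise orthogonal B" "\<And>b. b \<in> B \<Longrightarrow> norm b = 1"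
    "\<And>b. b \<in> B \<Longrightarrow> A *v b = ev b *\<^sub>R b" "span B = UNIV"
proof -
  have "\<exists>B ev. B \<subseteq> UNIV \<and> pairwise orthogonal B \<and> (\<forall>b\<in>B. norm b = 1 \<and> A *v b = ev b *\<^sub>R b) \<and> span B = UNIV"
    by (rule selfadjoint_eigenbasis_subspace) (auto simp: inner_symmetric_matrix[OF assms])
  then obtain B ev where "pairwise orthogonal B" "\<forall>b\<in>B. norm b = 1 \<and> A *v b = ev b *\<^sub>R b" "span B = UNIV"
    by blast
  then show thesis by (intro that[of B ev]) auto
qed

text \<open>This justifies the definite description in \<open>pd_sqrt\<close>. Existence comes from
  the spectral decomposition of \<open>A\<close>.\<close>

lemma ex1_pd_sqrt:
  fixes A :: "real^'n^'n"
  assumes sym: "transpose A = A" and pd: "\<And>x. x \<noteq> 0 \<Longrightarrow> x \<bullet> (A *v x) > 0"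
  shows "\<exists>!R. transpose R = R \<and> (\<forall>x. x \<noteq> 0 \<longrightarrow> x \<bullet> (R *v x) > 0) \<and> R ** R = A"
proof -
  obtain B ev where
    B: "pairwise orthogonal B" "\<And>b. b \<in> B \<Longrightarrow> norm b = 1"
    and ev: "\<And>b. b \<in> B \<Longrightarrow> A *v b = ev b *\<^sub>R b" and sp: "span B = UNIV"
    by (rule symmetric_matrix_eigenbasis[OF sym]) blast
  have fin: "finite B"
    using B by (intro independent_imp_finite pairwise_orthogonal_independent) (auto dest: B(2))
  have bb: "b \<bullet> c = (if b = c then 1 else 0)" if "b \<in> B" "c \<in> B" for b c
    using that B by (auto simp: pairwise_def orthogonal_def dot_square_norm)
  have ex: "x = (\<Sum>b\<in>B. (b \<bullet> x) *\<^sub>R b)" for x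
    using orthonormal_expansion[OF B] sp by simp
  have ev_pos: "ev b > 0" if "b \<in> B" for b
  proof -
    have "b \<noteq> 0" using B(2)[OF that] by auto
    with pd[of b] show ?thesis using ev[OF that] bb[OF that that] by simp
  qed
  \<comment> \<open>The root has the same eigenvectors as \<open>A\<close> and the square roots of
    its eigenvalues.\<close>
  define r where "r x = (\<Sum>b\<in>B. (sqrt (ev b) * (b \<bullet> x)) *\<^sub>R b)" for x
  define R where "R = matrix r"
  have lin: "linear r"
    by (rule linearI) (auto simp: r_def inner_add_right algebra_simps sum.distrib scaleR_sum_right)
  have Rv: "R *v x = r x" for x by (simp add: R_def matrix_works lin)
  have rb: "b \<bullet> r x = sqrt (ev b) * (b \<bullet> x)" if "b \<in> B" for b x
    using that fin by (simp add: r_def inner_sum_right bb if_distrib[of "(*) _"] cong: if_cong)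
  have ip: "x \<bullet> y = (\<Sum>b\<in>B. (b \<bullet> x) * (b \<bullet> y))" for x y
    by (subst ex[of x]) (simp add: inner_sum_left)
  have rsym: "r x \<bullet> y = x \<bullet> r y" for x y
    by (subst (1 2) ip) (simp add: rb algebra_simps)
  have Rsym: "transpose R = R"
  proof -
    have "transpose R *v x = R *v x" for x
    proof (rule vector_eq_ldot[THEN iffD1], rule allI)
      fix z
      have "z \<bullet> (transpose R *v x) = r z \<bullet> x"
        by (metis Rv dot_lmul_matrix inner_commute transpose_matrix_vector transpose_transpose)
      then show "z \<bullet> (transpose R *v x) = z \<bullet> (R *v x)" by (simp add: Rv rsym)
    qed
    then show ?thesis by (simp add: matrix_eq)
  qed
  have Rpd: "x \<bullet> (R *v x) > 0" if "x \<noteq> 0" for x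
  proof -
    have nz: "\<exists>b\<in>B. b \<bullet> x \<noteq> 0" using ex[of x] that by (metis (no_types, lifting) scaleR_zero_left sum.neutral)
    have "x \<bullet> (R *v x) = (\<Sum>b\<in>B. sqrt (ev b) * (b \<bullet> x)\<^sup>2)"
      by (subst ip) (simp add: Rv rb power2_eq_square algebra_simps)
    also have "\<dots> > 0"
    proof -
      obtain b where "b \<in> B" "b \<bullet> x \<noteq> 0" using nz by blast
      then show ?thesis using fin ev_pos
        by (intro sum_pos2[of _ b]) (auto intro!: mult_nonneg_nonneg simp: less_imp_le)
    qed
    finally show ?thesis .
  qed
  have RR: "R ** R = A"
  proof -
    have "(R ** R) *v x = A *v x" for x
    proof -
      have "A *v x = (\<Sum>b\<in>B. (b \<bullet> x) *\<^sub>R (A *v b))"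
        by (subst ex[of x]) (simp add: linear_sum[OF matrix_vector_mul_linear] linear_cmul[OF matrix_vector_mul_linear])
      also have "\<dots> = (\<Sum>b\<in>B. (sqrt (ev b) * (b \<bullet> r x)) *\<^sub>R b)"
      proof (intro sum.cong refl)
        fix b assume b: "b \<in> B"
        have "sqrt (ev b) * (sqrt (ev b) * (b \<bullet> x)) = ev b * (b \<bullet> x)"
          using ev_pos[OF b] by (simp add: mult.assoc[symmetric])
        then show "(b \<bullet> x) *\<^sub>R (A *v b) = (sqrt (ev b) * (b \<bullet> r x)) *\<^sub>R b"
          using b ev_pos[OF b] by (simp add: rb ev mult.commute[of "b \<bullet> x"])
      qed
      also have "\<dots> = r (r x)" by (simp add: r_def[of "r x"])
      finally show ?thesis by (simp add: matrix_vector_mul_assoc[symmetric] Rv)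
    qed
    then show ?thesis by (simp add: matrix_eq)
  qed
  show ?thesis
  proof (rule ex1I[of _ R])
    show "transpose R = R \<and> (\<forall>x. x \<noteq> 0 \<longrightarrow> x \<bullet> (R *v x) > 0) \<and> R ** R = A"
      using Rsym Rpd RR by blast
    txt \<open>If \<open>R\<close> and \<open>S\<close> are two roots, an eigenvector \<open>b\<close> of \<open>R - S\<close> with eigenvalue \<open>\<mu>\<close> satisfies
      \<open>\<mu> * (b \<bullet> R b + b \<bullet> S b) = \<parallel>R b\<parallel>\<^sup>2 - \<parallel>S b\<parallel>\<^sup>2 = 0\<close>, hence \<open>\<mu> = 0\<close>.\<close>
    fix S :: "real^'n^'n"
    assume S: "transpose S = S \<and> (\<forall>x. x \<noteq> 0 \<longrightarrow> x \<bullet> (S *v x) > 0) \<and> S ** S = A"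
    have "transpose (R - S) = R - S"
      using S Rsym by (simp add: transpose_def vec_eq_iff)
    then obtain E mu where
      E: "pairwise orthogonal E" "\<And>b. b \<in> E \<Longrightarrow> norm b = 1"
      and mu: "\<And>b. b \<in> E \<Longrightarrow> (R - S) *v b = mu b *\<^sub>R b" and spE: "span E = UNIV"
      by (rule symmetric_matrix_eigenbasis) blast
    have "mu b = 0" if b: "b \<in> E" for b
    proof -
      have b0: "b \<noteq> 0" using E(2)[OF b] by auto
      have d: "R *v b = S *v b + mu b *\<^sub>R b"
        using mu[OF b] by (simp add: matrix_vector_mult_diff_rdistrib algebra_simps)
      have "(R *v b) \<bullet> (R *v b) = b \<bullet> (A *v b)"
        using inner_symmetric_matrix[OF Rsym, of b "R *v b"] RR by (simp add: matrix_vector_mul_assoc)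
      moreover have "(S *v b) \<bullet> (S *v b) = b \<bullet> (A *v b)"
        using inner_symmetric_matrix[of S b "S *v b"] S by (simp add: matrix_vector_mul_assoc)
      moreover have "(R *v b) \<bullet> (R *v b) - (S *v b) \<bullet> (S *v b) = mu b * (b \<bullet> (R *v b) + b \<bullet> (S *v b))"
        by (simp add: d inner_add_left inner_add_right inner_commute algebra_simps)
      ultimately have "mu b * (b \<bullet> (R *v b) + b \<bullet> (S *v b)) = 0" by simp
      moreover have "b \<bullet> (R *v b) + b \<bullet> (S *v b) > 0"
        using b0 Rpd S by (intro add_pos_pos) auto
      ultimately show ?thesis by simp
    qed
    then have "(R - S) *v b = 0 *v b" if "b \<in> E" for b using mu[OF that] that by simp
    then have "(R - S) *v x = 0 *v x" for x
      using linear_eq_on_span[of "(*v) (R - S)" "(*v) 0" E x] spE by auto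
    then have "R - S = 0" by (subst matrix_eq) simp
    then show "S = R" by simp
  qed
qed

lemma pd_matrix_invertible:
  fixes A :: "real^'n^'n"
  assumes pd: "\<And>x. x \<noteq> 0 \<Longrightarrow> x \<bullet> (A *v x) > 0"
  shows "invertible A"
proof -
  have "inj ((*v) A)"
    using pd by (subst linear_injective_0[OF matrix_vector_mul_linear]) (metis inner_zero_right less_irrefl)
  then show ?thesis
    by (simp add: invertible_left_inverse matrix_left_invertible_injective)
qed

text \<open>\<open>matrix_inv\<close> is a Hilbert choice of a two-sided inverse; invertibility
  makes the choice meaningful.\<close>

lemma matrix_inv_inverse:
  fixes A :: "real^'n^'n"
  assumes "invertible A"
  shows "A ** matrix_inv A = mat 1" "matrix_inv A ** A = mat 1"
  using someI_ex[OF assms[unfolded invertible_def]] by (simp_all add: matrix_inv_def)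

lemma matrix_inv_vector_cancel:
  fixes A :: "real^'n^'n"
  assumes "invertible A"
  shows "A *v (matrix_inv A *v x) = x" "matrix_inv A *v (A *v x) = x"
  using assms by (simp_all add: matrix_vector_mul_assoc matrix_inv_inverse)

text \<open>Let \<open>R\<close> be the root, and let \<open>y\<close> and \<open>z\<close> solve
  \<open>R *v y = x\<close> and \<open>A *v z = x\<close>. Then \<open>R *v z = y\<close>, and
  symmetry of \<open>R\<close> gives
  \<open>y \<bullet> y = z \<bullet> (R *v y) = z \<bullet> x\<close>.\<close>

lemma norm_inverse_pd_sqrt:
  fixes A :: "real^'n^'n"
  assumes sym: "transpose A = A" and pd: "\<And>x. x \<noteq> 0 \<Longrightarrow> x \<bullet> (A *v x) > 0"
  shows "(norm (matrix_inv (pd_sqrt A) *v x))\<^sup>2 = x \<bullet> (matrix_inv A *v x)"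
proof -
  have R: "transpose (pd_sqrt A) = pd_sqrt A \<and> (\<forall>x. x \<noteq> 0 \<longrightarrow> x \<bullet> (pd_sqrt A *v x) > 0) \<and> pd_sqrt A ** pd_sqrt A = A"
    unfolding pd_sqrt_def by (rule theI'[OF ex1_pd_sqrt[OF assms]])
  define R where "R = pd_sqrt A"
  have iR: "invertible R" using R by (intro pd_matrix_invertible) (simp add: R_def)
  have iA: "invertible A" using pd by (rule pd_matrix_invertible)
  define y where "y = matrix_inv R *v x"
  define z where "z = matrix_inv A *v x"
  have Ry: "R *v y = x" by (simp add: y_def matrix_inv_vector_cancel iR)
  have "R *v (R *v z) = x"
    using R by (metis R_def z_def matrix_vector_mul_assoc matrix_inv_vector_cancel(1)[OF iA])
  then have "R *v z = y"
    by (metis y_def matrix_inv_vector_cancel(2)[OF iR])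
  then have "y \<bullet> y = x \<bullet> z"
    using inner_symmetric_matrix[of R y z] R Ry by (simp add: R_def)
  then show ?thesis by (simp add: y_def z_def R_def dot_square_norm)
qed

section \<open>Noncentral chi-squared densities\<close>

lemma chi2_density_nonneg: "k > 0 \<Longrightarrow> chi2_density k q \<ge> 0"
  by (simp add: chi2_density_def)

lemma borel_measurable_chi2_density [measurable]: "chi2_density k \<in> borel_measurable borel"
  unfolding chi2_density_def[abs_def] by measurable

text \<open>The scaling \<open>y = x * u\<close> confines \<open>u\<close> to the unit interval and
  leaves a Beta integral, whose Gamma factors cancel against the normalising constants.\<close>

lemma chi2_density_convolution:
  assumes a: "a > 0" and b: "b > 0"
  shows "(\<integral>\<^sup>+y. ennreal (chi2_density a (x - y)) * ennreal (chi2_density b y) \<partial>lborel) = ennreal (chi2_density (a + b) x)"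
proof (cases "x > 0")
  case False
  then have "ennreal (chi2_density a (x - y)) * ennreal (chi2_density b y) = 0" for y
    by (simp add: chi2_density_def)
  then show ?thesis using False by (simp only: nn_integral_const) (simp add: chi2_density_def)
next
  case x: True
  \<comment> \<open>\<open>K\<close> collects the factors free of \<open>u\<close>. Its exponent of
    \<open>x\<close> is one below that of the target density; the Jacobian \<open>x\<close> supplies
    the difference.\<close>
  define K where "K = x powr ((a + b) / 2 - 2) * exp (- x / 2) / (2 powr ((a + b) / 2) * Gamma (a / 2) * Gamma (b / 2))"
  have K: "K \<ge> 0" using a b by (simp add: K_def)
  have "(\<integral>\<^sup>+y. ennreal (chi2_density a (x - y)) * ennreal (chi2_density b y) \<partial>lborel)
    = ennreal x * (\<integral>\<^sup>+u. ennreal (chi2_density a (x - x * u)) * ennreal (chi2_density b (x * u)) \<partial>lborel)"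
    using x by (subst nn_integral_real_affine[where c = x and t = 0]) auto
  also have "(\<integral>\<^sup>+u. ennreal (chi2_density a (x - x * u)) * ennreal (chi2_density b (x * u)) \<partial>lborel)
    = (\<integral>\<^sup>+u. ennreal K * (ennreal (u powr (b / 2 - 1) * (1 - u) powr (a / 2 - 1)) * indicator {0..1} u) \<partial>lborel)"
  proof (rule nn_integral_cong)
    fix u :: real
    show "ennreal (chi2_density a (x - x * u)) * ennreal (chi2_density b (x * u))
      = ennreal K * (ennreal (u powr (b / 2 - 1) * (1 - u) powr (a / 2 - 1)) * indicator {0..1} u)"
    proof (cases "0 < u \<and> u < 1")
      case True
      then have xu: "x - x * u = x * (1 - u)" "0 < x * (1 - u)" "0 < x * u"
        using x by (auto simp: algebra_simps)
      have "chi2_density a (x - x * u) * chi2_density b (x * u) =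
        (x powr (a / 2 - 1) * x powr (b / 2 - 1)) * (exp (- (x * (1 - u)) / 2) * exp (- (x * u) / 2)) *
        (u powr (b / 2 - 1) * (1 - u) powr (a / 2 - 1)) / ((2 powr (a / 2) * 2 powr (b / 2)) * Gamma (a / 2) * Gamma (b / 2))"
        using True x xu by (simp add: chi2_density_def powr_mult mult_ac)
      also have "x powr (a / 2 - 1) * x powr (b / 2 - 1) = x powr ((a + b) / 2 - 2)"
        by (simp add: powr_add[symmetric] add_divide_distrib)
      also have "exp (- (x * (1 - u)) / 2) * exp (- (x * u) / 2) = exp (- x / 2)"
        by (simp add: exp_add[symmetric] algebra_simps add_divide_distrib[symmetric])
      also have "2 powr (a / 2) * 2 powr (b / 2) = 2 powr ((a + b) / 2)"
        by (simp add: powr_add[symmetric] add_divide_distrib)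
      finally have "chi2_density a (x - x * u) * chi2_density b (x * u) = K * (u powr (b / 2 - 1) * (1 - u) powr (a / 2 - 1))"
        by (simp add: K_def)
      then show ?thesis
        using True K a b by (simp add: ennreal_mult[symmetric] chi2_density_nonneg)
    next
      case False
      \<comment> \<open>At the endpoints \<open>0 powr p = 0\<close> for every \<open>p\<close>, so
        the Beta integrand vanishes there together with one of the two densities.\<close>
      then have "u \<le> 0 \<or> u \<ge> 1" by auto
      then show ?thesis
      proof
        assume "u \<le> 0"
        then have "x * u \<le> 0" using x by (simp add: mult_nonneg_nonpos)
        then show ?thesis using \<open>u \<le> 0\<close>
          by (cases "u = 0") (auto simp: chi2_density_def)
      next
        assume "u \<ge> 1"
        then have "x - x * u \<le> 0" using x by simp
        then show ?thesis using \<open>u \<ge> 1\<close>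
          by (cases "u = 1") (auto simp: chi2_density_def)
      qed
    qed
  qed
  also have "\<dots> = ennreal K * ennreal (Beta (b / 2) (a / 2))"
    using nn_integral_has_integral_lebesgue'[OF _ has_integral_Beta_real[of "b / 2" "a / 2"]] a b
    by (subst nn_integral_cmult) (auto simp: mult.commute)
  also have "ennreal x * (ennreal K * ennreal (Beta (b / 2) (a / 2))) = ennreal (x * K * Beta (b / 2) (a / 2))"
    using x K a b by (simp add: ennreal_mult[symmetric] Beta_def mult.assoc)
  also have "x * K * Beta (b / 2) (a / 2) = chi2_density (a + b) x"
  proof -
    have "x * x powr ((a + b) / 2 - 2) = x powr ((a + b) / 2 - 1)"
      using x powr_add[of x 1 "(a + b) / 2 - 2"] by simp
    moreover have nz: "Gamma (a / 2) \<noteq> 0" "Gamma (b / 2) \<noteq> 0" using a b by (simp_all add: less_imp_neq[symmetric])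
    moreover have "b / 2 + a / 2 = (a + b) / 2" by simp
    moreover have id: "x * (p * e / (d * A * B)) * (B * A / G) = (x * p) * e / (d * G)"
      if "A \<noteq> 0" "B \<noteq> 0" for p e d A B G :: real
      using that by (simp add: mult_ac)
    ultimately show ?thesis
      using x unfolding K_def Beta_def by (subst id[OF nz]) (simp add: chi2_density_def add.commute[of "b / 2"] add_divide_distrib)
  qed
  finally show ?thesis .
qed

text \<open>Each step of the functional equation contributes a factor at least \<open>x\<close>.
  This crude bound is enough to dominate the mixture densities geometrically in
  \<open>j\<close>.\<close>

lemma Gamma_add_of_nat_ge:
  fixes x :: real
  assumes "x > 0"
  shows "Gamma (x + real j) \<ge> x ^ j * Gamma x"
proof (induction j)
  case (Suc j)
  have "x ^ Suc j * Gamma x \<le> (x + real j) * (x ^ j * Gamma x)"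
    using assms by (simp add: mult.assoc[symmetric])
  also have "\<dots> \<le> (x + real j) * Gamma (x + real j)"
    using Suc assms by (intro mult_left_mono) auto
  also have "\<dots> = Gamma (x + real (Suc j))"
  proof -
    have "x + real j \<notin> \<int>\<^sub>\<le>\<^sub>0"
      using assms by (auto elim!: nonpos_Ints_cases)
    then show ?thesis using Gamma_plus1[of "x + real j"] by (simp add: add_ac)
  qed
  finally show ?case .
qed simp

lemma summable_ncchi2_density:
  assumes k: "k > 0" and lam: "lam \<ge> 0"
  shows "summable (\<lambda>j. exp (- lam / 2) * (lam / 2) ^ j / fact j * chi2_density (k + 2 * real j) q)"
proof (cases "q > 0")
  case q: True
  define P where "P = q powr (k / 2 - 1) * exp (- q / 2) / (2 powr (k / 2) * Gamma (k / 2))"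
  \<comment> \<open>The factor \<open>q / 2\<close> comes from the powers of \<open>q\<close> and 2
    in the density, the factor \<open>k / 2\<close> from the Gamma bound. Together with the Poisson
    weights this leaves the exponential series at \<open>lam / 2 * r\<close>.\<close>
  define r where "r = q / 2 / (k / 2)"
  have bd: "chi2_density (k + 2 * real j) q \<le> P * r ^ j" for j
  proof -
    have 1: "(k + 2 * real j) / 2 = k / 2 + real j" by simp
    have "q powr (k / 2 + real j - 1) = q powr (k / 2 - 1) * q ^ j"
      using q powr_add[of q "k / 2 - 1" "real j"] by (simp add: powr_realpow algebra_simps)
    moreover have "2 powr (k / 2 + real j) = 2 powr (k / 2) * 2 ^ j"
      by (simp add: powr_add powr_realpow)
    ultimately have "chi2_density (k + 2 * real j) q = q powr (k / 2 - 1) * q ^ j * exp (- q / 2) / (2 powr (k / 2) * 2 ^ j * Gamma (k / 2 + real j))"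
      using q unfolding chi2_density_def 1 by simp
    also have "\<dots> \<le> q powr (k / 2 - 1) * q ^ j * exp (- q / 2) / (2 powr (k / 2) * 2 ^ j * ((k / 2) ^ j * Gamma (k / 2)))"
      using Gamma_add_of_nat_ge[of "k / 2" j] k q
      by (intro divide_left_mono mult_left_mono mult_pos_pos) auto
    also have "\<dots> = P * r ^ j"
      by (simp add: P_def r_def power_divide power_mult_distrib mult_ac)
    finally show ?thesis .
  qed
  have le: "exp (- lam / 2) * (lam / 2) ^ j / fact j * chi2_density (k + 2 * real j) q \<le> exp (- lam / 2) * P * ((lam / 2 * r) ^ j /\<^sub>R fact j)" for j
  proof -
    have "exp (- lam / 2) * (lam / 2) ^ j / fact j * chi2_density (k + 2 * real j) q \<le>
      exp (- lam / 2) * (lam / 2) ^ j / fact j * (P * r ^ j)"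
      using lam by (intro mult_left_mono bd) auto
    also have "\<dots> = exp (- lam / 2) * P * ((lam / 2 * r) ^ j /\<^sub>R fact j)"
      by (simp only: power_mult_distrib real_scaleR_def divide_inverse mult_ac)
    finally show ?thesis .
  qed
  have "summable (\<lambda>j. exp (- lam / 2) * P * ((lam / 2 * r) ^ j /\<^sub>R fact j))"
    by (intro summable_mult summable_exp_generic)
  then show ?thesis
  proof (rule summable_comparison_test')
    fix j
    have "exp (- lam / 2) * (lam / 2) ^ j / fact j * chi2_density (k + 2 * real j) q \<ge> 0"
      using k lam by (intro mult_nonneg_nonneg divide_nonneg_nonneg chi2_density_nonneg) auto
    then show "norm (exp (- lam / 2) * (lam / 2) ^ j / fact j * chi2_density (k + 2 * real j) q)
      \<le> exp (- lam / 2) * P * ((lam / 2 * r) ^ j /\<^sub>R fact j)"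
      using le[of j] by (simp only: real_norm_def abs_of_nonneg)
  qed
qed (simp add: chi2_density_def)

text \<open>In \<open>ennreal\<close> the mixture may be integrated term by term without any further
  summability argument.\<close>

lemma ennreal_ncchi2_density:
  assumes k: "k > 0" and lam: "lam \<ge> 0"
  shows "ennreal (ncchi2_density k lam q) =
    (\<Sum>j. ennreal (exp (- lam / 2) * (lam / 2) ^ j / fact j) * ennreal (chi2_density (k + 2 * real j) q))"
proof -
  have "ennreal (ncchi2_density k lam q) =
    (\<Sum>j. ennreal (exp (- lam / 2) * (lam / 2) ^ j / fact j * chi2_density (k + 2 * real j) q))"
    unfolding ncchi2_density_def using k lam
    by (intro suminf_ennreal2[symmetric] summable_ncchi2_density) (auto simp: chi2_density_nonneg)
  then show ?thesis
    using k lam by (simp only: ennreal_mult chi2_density_nonneg divide_nonneg_nonneg mult_nonneg_nonneg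
        exp_ge_zero zero_le_power add_pos_nonneg of_nat_0_le_iff fact_ge_zero zero_le_numeral)
qed

lemma ncchi2_density_nonneg: "k > 0 \<Longrightarrow> lam \<ge> 0 \<Longrightarrow> ncchi2_density k lam q \<ge> 0"
  unfolding ncchi2_density_def
  by (intro suminf_nonneg summable_ncchi2_density) (auto simp: chi2_density_nonneg)

lemma ncchi2_density_nonpos: "q \<le> 0 \<Longrightarrow> ncchi2_density k lam q = 0"
  by (simp add: ncchi2_density_def chi2_density_def)

lemma ncchi2_density_0: "ncchi2_density k 0 = chi2_density k"
proof
  fix q
  have "(\<lambda>j. exp (- 0 / 2) * (0 / 2) ^ j / fact j * chi2_density (k + 2 * real j) q)
    = (\<lambda>j. if j = 0 then chi2_density (k + 2 * real j) q else 0)"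
    by (auto simp: power_0_left)
  then have "(\<lambda>j. exp (- 0 / 2) * (0 / 2) ^ j / fact j * chi2_density (k + 2 * real j) q) sums chi2_density k q"
    using sums_single[of 0 "\<lambda>j. chi2_density (k + 2 * real j) q"] by simp
  then show "ncchi2_density k 0 q = chi2_density k q"
    by (simp add: ncchi2_density_def sums_iff)
qed

lemma borel_measurable_ncchi2_density [measurable]: "ncchi2_density k lam \<in> borel_measurable borel"
  unfolding ncchi2_density_def[abs_def] by measurable

lemma chi2_ncchi2_density_convolution:
  assumes a: "a > 0" and k: "k > 0" and lam: "lam \<ge> 0"
  shows "(\<integral>\<^sup>+y. ennreal (chi2_density a (x - y)) * ennreal (ncchi2_density k lam y) \<partial>lborel) = ennreal (ncchi2_density (a + k) lam x)"
proof -
  let ?c = "\<lambda>j. ennreal (exp (- lam / 2) * (lam / 2) ^ j / fact j)"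
  have "(\<integral>\<^sup>+y. ennreal (chi2_density a (x - y)) * ennreal (ncchi2_density k lam y) \<partial>lborel)
    = (\<integral>\<^sup>+y. (\<Sum>j. ?c j * (ennreal (chi2_density a (x - y)) * ennreal (chi2_density (k + 2 * real j) y))) \<partial>lborel)"
    by (intro nn_integral_cong, subst ennreal_ncchi2_density[OF k lam], subst ennreal_suminf_cmult[symmetric])
       (simp only: mult.left_commute)
  also have "\<dots> = (\<Sum>j. ?c j * ennreal (chi2_density (a + k + 2 * real j) x))"
    using a k by (simp add: nn_integral_suminf nn_integral_cmult chi2_density_convolution add.assoc)
  also have "\<dots> = ennreal (ncchi2_density (a + k) lam x)"
    using a k lam by (simp add: ennreal_ncchi2_density)
  finally show ?thesis .
qed

text \<open>At one degree of freedom this places \<open>fact (2 * j)\<close> in the denominator of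
  the mixture terms, as in the cosh series, while \<open>fact j\<close> cancels against the Poisson
  weight.\<close>

lemma Gamma_half_add_nat: "Gamma (1 / 2 + real j) = sqrt pi * fact (2 * j) / (2 ^ (2 * j) * fact j)"
proof -
  have "(1 / 2 :: real) \<notin> \<int>\<^sub>\<le>\<^sub>0" by (auto elim!: nonpos_Ints_cases)
  then have "pochhammer (1 / 2) j = Gamma (1 / 2 + real j) / sqrt pi"
    using pochhammer_Gamma[of "1 / 2 :: real" j] by (simp add: Gamma_one_half_real)
  then show ?thesis
    using fact_double[of j, where ?'a = real] by (simp add: field_simps)
qed

text \<open>Both sides are the density at \<open>v\<close> of the absolute value of a normal
  variable with mean \<open>g\<close> and variance 1: on the left through its square, with Jacobian
  \<open>2 * v\<close>, on the right as the sum over the two branches.\<close>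

lemma ncchi2_density_one:
  assumes v: "v > 0"
  shows "ncchi2_density 1 (g\<^sup>2) (v\<^sup>2) * (2 * v) = std_normal_density (v - g) + std_normal_density (v + g)"
proof -
  let ?T = "\<lambda>j. exp (- g\<^sup>2 / 2) * (g\<^sup>2 / 2) ^ j / fact j * chi2_density (1 + 2 * real j) (v\<^sup>2)"
  \<comment> \<open>\<open>E * cosh (v * g)\<close> is the sum of the two shifted normal densities
    after the cross terms \<open>exp (v * g)\<close> and \<open>exp (- (v * g))\<close> are split
    off.\<close>
  define E where "E = 2 / sqrt (2 * pi) * exp (- g\<^sup>2 / 2) * exp (- v\<^sup>2 / 2)"
  have T: "?T j * (2 * v) = E * ((v * g) ^ (2 * j) /\<^sub>R fact (2 * j))" for j
  proof -
    have 1: "(1 + 2 * real j) / 2 = 1 / 2 + real j" by simp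
    have "(v\<^sup>2) powr (1 / 2 + real j - 1) = v ^ (2 * j) / v"
    proof -
      have "(v\<^sup>2) powr (1 / 2 + real j - 1) = (v powr 2) powr (real j - 1 / 2)"
        using v by simp
      also have "\<dots> = v powr (real (2 * j) - 1)" by (simp add: powr_powr algebra_simps)
      also have "\<dots> = v ^ (2 * j) / v"
        using v by (simp only: powr_diff powr_realpow powr_one)
      finally show ?thesis .
    qed
    moreover have "2 powr (1 / 2 + real j) = sqrt 2 * 2 ^ j"
      by (simp add: powr_add powr_realpow powr_half_sqrt)
    ultimately have chi: "chi2_density (1 + 2 * real j) (v\<^sup>2)
      = v ^ (2 * j) / v * exp (- v\<^sup>2 / 2) / (sqrt 2 * 2 ^ j * (sqrt pi * fact (2 * j) / (2 ^ (2 * j) * fact j)))"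
      using v unfolding chi2_density_def 1 by (simp add: Gamma_half_add_nat)
    have pw: "(g\<^sup>2 / 2) ^ j = g ^ (2 * j) / 2 ^ j" "(2::real) ^ (2 * j) = 2 ^ j * 2 ^ j"
      by (simp_all add: power_divide power_mult mult_2 power_add power2_eq_square power_mult_distrib)
    have cancel: "e1 * (G / t) / F * (A / v * e2 / (s2 * t * (sp * D / (t * t * F)))) * (2 * v) = 2 / (s2 * sp) * e1 * e2 * (A * G / D)"
      if "t \<noteq> 0" "F \<noteq> 0" "s2 \<noteq> 0" "sp \<noteq> 0" "D \<noteq> 0" for e1 G t F A e2 s2 sp D :: real
      using v that by (simp add: field_simps)
    have "?T j * (2 * v) = 2 / (sqrt 2 * sqrt pi) * exp (- g\<^sup>2 / 2) * exp (- v\<^sup>2 / 2) * (v ^ (2 * j) * g ^ (2 * j) / fact (2 * j))"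
      unfolding chi pw by (rule cancel) simp_all
    then show ?thesis
      by (simp only: E_def real_sqrt_mult power_mult_distrib real_scaleR_def divide_inverse mult_ac)
  qed
  \<comment> \<open>The cosh series carries zeros at odd positions; dropping them reindexes it by
    \<open>2 * j\<close>.\<close>
  have even: "(if even n then (v * g) ^ n /\<^sub>R fact n else 0) = 0" if "n \<notin> range ((*) 2)" for n
    using that by (auto elim!: evenE)
  have "(\<lambda>j. (v * g) ^ (2 * j) /\<^sub>R fact (2 * j)) sums cosh (v * g)"
    using sums_mono_reindex[of "\<lambda>j. 2 * j" "\<lambda>n. if even n then (v * g) ^ n /\<^sub>R fact n else 0" "cosh (v * g)"]
      cosh_converges[of "v * g"] even by (simp add: strict_mono_def)
  then have "(\<lambda>j. ?T j * (2 * v)) sums (E * cosh (v * g))"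
    unfolding T by (rule sums_mult)
  moreover have "(\<lambda>j. ?T j * (2 * v)) sums (ncchi2_density 1 (g\<^sup>2) (v\<^sup>2) * (2 * v))"
    unfolding ncchi2_density_def
    by (intro sums_mult2 summable_sums summable_ncchi2_density) auto
  ultimately have "ncchi2_density 1 (g\<^sup>2) (v\<^sup>2) * (2 * v) = E * cosh (v * g)"
    by (rule sums_unique2[symmetric])
  also have "\<dots> = std_normal_density (v - g) + std_normal_density (v + g)"
  proof -
    have e: "exp (- (v - g)\<^sup>2 / 2) = exp (- g\<^sup>2 / 2) * exp (- v\<^sup>2 / 2) * exp (v * g)"
      "exp (- (v + g)\<^sup>2 / 2) = exp (- g\<^sup>2 / 2) * exp (- v\<^sup>2 / 2) * exp (- (v * g))"
      by (simp_all add: exp_add[symmetric] power2_eq_square field_simps)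
    have sum: "2 / r * a * b * (inverse 2 * (c + d)) = 1 / r * (a * b * c) + 1 / r * (a * b * d)" for r a b c d :: real
      by (simp add: algebra_simps add_divide_distrib)
    show ?thesis
      unfolding std_normal_density_def E_def cosh_def real_scaleR_def e by (rule sum)
  qed
  finally show ?thesis .
qed

section \<open>Laws of squares, sums of squares and scaled square roots\<close>

lemma distributed_nonneg_atMostI:
  fixes X :: "'a \<Rightarrow> real"
  assumes "prob_space M" and [measurable]: "X \<in> borel_measurable M"
    and f[measurable]: "f \<in> borel_measurable borel" and f0: "\<And>x. 0 \<le> f x" "\<And>x. x \<le> 0 \<Longrightarrow> f x = 0"
    and nn: "\<And>\<omega>. \<omega> \<in> space M \<Longrightarrow> X \<omega> \<ge> 0"
    and eq: "\<And>a. a \<ge> 0 \<Longrightarrow> emeasure M {\<omega> \<in> space M. X \<omega> \<le> a} = (\<integral>\<^sup>+x. ennreal (f x) * indicator {0..a} x \<partial>lborel)"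
  shows "distributed M lborel X (\<lambda>x. ennreal (f x))"
proof -
  interpret prob_space M by fact
  show ?thesis
  proof (rule distributedI_borel_atMost[where g = "\<lambda>a. prob {\<omega> \<in> space M. X \<omega> \<le> a}"])
    fix a
    show "(\<integral>\<^sup>+x. ennreal (f x * indicator {..a} x) \<partial>lborel) = ennreal (prob {\<omega> \<in> space M. X \<omega> \<le> a})"
    proof (cases "a \<ge> 0")
      case True
      have "(\<integral>\<^sup>+x. ennreal (f x * indicator {..a} x) \<partial>lborel) = (\<integral>\<^sup>+x. ennreal (f x) * indicator {0..a} x \<partial>lborel)"
        by (intro nn_integral_cong) (auto simp: indicator_def f0)
      then show ?thesis using eq[OF True] by (simp add: emeasure_eq_measure)
    next
      case False
      then have *: "f x * indicator {..a} x = 0" for x by (auto simp: indicator_def f0)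
      have "{\<omega> \<in> space M. X \<omega> \<le> a} = {}" using False nn by force
      then show ?thesis by (simp only: *) simp
    qed
  qed (auto simp: emeasure_eq_measure f0)
qed

text \<open>The interval for \<open>Z + g\<close> is cut at 0 and its negative half reflected, so
  the two branches of \<open>ncchi2_density_one\<close> appear; the substitution by
  \<open>x\<^sup>2\<close> then gives the density of the square.\<close>

lemma distributed_square_shifted_std_normal:
  fixes Z :: "'a \<Rightarrow> real"
  assumes M: "prob_space M" and Z: "distributed M lborel Z (\<lambda>x. ennreal (std_normal_density x))"
  shows "distributed M lborel (\<lambda>\<omega>. (Z \<omega> + g)\<^sup>2) (\<lambda>q. ennreal (ncchi2_density 1 (g\<^sup>2) q))"
proof (rule distributed_nonneg_atMostI)
  show "prob_space M" by (rule M)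
  have [measurable]: "Z \<in> borel_measurable M" using distributed_measurable[OF Z] by simp
  show "(\<lambda>\<omega>. (Z \<omega> + g)\<^sup>2) \<in> borel_measurable M" by measurable
  fix a :: real assume a: "a \<ge> 0"
  define r where "r = sqrt a"
  have r: "r \<ge> 0" "a = r\<^sup>2" using a by (simp_all add: r_def)
  let ?p = "\<lambda>x. ennreal (std_normal_density x)"
  have "{\<omega> \<in> space M. (Z \<omega> + g)\<^sup>2 \<le> a} = Z -` {- r - g..r - g} \<inter> space M"
    using r by (auto simp: abs_le_square_iff[of "_ + _" r, symmetric] abs_le_iff)
  then have "emeasure M {\<omega> \<in> space M. (Z \<omega> + g)\<^sup>2 \<le> a} = (\<integral>\<^sup>+x. ?p x * indicator {- r - g..r - g} x \<partial>lborel)"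
    using distributed_emeasure[OF Z] by simp
  also have "\<dots> = (\<integral>\<^sup>+x. ?p (x - g) * indicator {- r..r} x \<partial>lborel)"
    by (subst nn_integral_real_affine[where c = 1 and t = "- g"])
       (auto intro!: nn_integral_cong simp: indicator_def)
  also have "\<dots> = (\<integral>\<^sup>+x. ?p (x - g) * indicator {0..r} x + ?p (x - g) * indicator {- r..<0} x \<partial>lborel)"
    using r by (intro nn_integral_cong) (auto simp: indicator_def)
  also have "\<dots> = (\<integral>\<^sup>+x. ?p (x - g) * indicator {0..r} x \<partial>lborel) + (\<integral>\<^sup>+x. ?p (x - g) * indicator {- r..<0} x \<partial>lborel)"
    by (rule nn_integral_add) auto
  also have "(\<integral>\<^sup>+x. ?p (x - g) * indicator {- r..<0} x \<partial>lborel) = (\<integral>\<^sup>+x. ?p (x + g) * indicator {0<..r} x \<partial>lborel)"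
    by (subst nn_integral_real_affine[where c = "-1" and t = 0])
       (auto intro!: nn_integral_cong simp: indicator_def std_normal_density_def power2_eq_square algebra_simps)
  also have "\<dots> = (\<integral>\<^sup>+x. ?p (x + g) * indicator {0..r} x \<partial>lborel)"
    \<comment> \<open>The point 0 is null, so the interval left half-open by the reflection may be
      closed. The same null set is discarded below, where the identity is available only for
      positive arguments.\<close>
    by (intro nn_integral_cong_AE) (use AE_lborel_singleton[of "0::real"] in \<open>eventually_elim, auto simp: indicator_def\<close>)
  also have "(\<integral>\<^sup>+x. ?p (x - g) * indicator {0..r} x \<partial>lborel) + \<dots>
    = (\<integral>\<^sup>+x. ?p (x - g) * indicator {0..r} x + ?p (x + g) * indicator {0..r} x \<partial>lborel)"
    by (rule nn_integral_add[symmetric]) auto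
  also have "\<dots> = (\<integral>\<^sup>+x. ennreal (ncchi2_density 1 (g\<^sup>2) (x\<^sup>2) * (2 * x) * indicator {0..r} x) \<partial>lborel)"
  proof (intro nn_integral_cong_AE)
    show "AE x in lborel. ?p (x - g) * indicator {0..r} x + ?p (x + g) * indicator {0..r} x
      = ennreal (ncchi2_density 1 (g\<^sup>2) (x\<^sup>2) * (2 * x) * indicator {0..r} x)"
      using AE_lborel_singleton[of "0::real"]
    proof eventually_elim
      case (elim x)
      then show ?case
        using ncchi2_density_one[of x g] by (auto simp: indicator_def ennreal_plus[symmetric] simp del: ennreal_plus)
    qed
  qed
  also have "\<dots> = (\<integral>\<^sup>+x. ennreal (ncchi2_density 1 (g\<^sup>2) x * indicator {0\<^sup>2..r\<^sup>2} x) \<partial>lborel)"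
    using r by (intro nn_integral_substitution[symmetric])
      (auto intro!: derivative_eq_intros continuous_intros simp: set_borel_measurable_def)
  also have "\<dots> = (\<integral>\<^sup>+x. ennreal (ncchi2_density 1 (g\<^sup>2) x) * indicator {0..a} x \<partial>lborel)"
    by (intro nn_integral_cong) (auto simp: indicator_def r)
  finally show "emeasure M {\<omega> \<in> space M. (Z \<omega> + g)\<^sup>2 \<le> a} = (\<integral>\<^sup>+x. ennreal (ncchi2_density 1 (g\<^sup>2) x) * indicator {0..a} x \<partial>lborel)" .
qed (auto simp: ncchi2_density_nonneg ncchi2_density_nonpos)

text \<open>The resulting density has exactly the shape of \<open>fV\<close> and \<open>fW\<close>,
  with \<open>c\<close> the degrees of freedom, so the lemma serves both \<open>V\<close> and
  \<open>W\<close>.\<close>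

lemma distributed_sqrt_divide:
  fixes Q :: "'a \<Rightarrow> real"
  assumes M: "prob_space M" and Q: "distributed M lborel Q (\<lambda>x. ennreal (f x))"
    and f[measurable]: "f \<in> borel_measurable borel" and f0: "\<And>x. 0 \<le> f x" "\<And>x. x \<le> 0 \<Longrightarrow> f x = 0"
    and nn: "\<And>\<omega>. \<omega> \<in> space M \<Longrightarrow> Q \<omega> \<ge> 0" and c: "c > 0"
  shows "distributed M lborel (\<lambda>\<omega>. sqrt (Q \<omega> / c)) (\<lambda>v. ennreal (if v > 0 then f (c * v\<^sup>2) * 2 * c * v else 0))"
proof (rule distributed_nonneg_atMostI)
  show "prob_space M" by (rule M)
  have [measurable]: "Q \<in> borel_measurable M" using distributed_measurable[OF Q] by simp
  show "(\<lambda>\<omega>. sqrt (Q \<omega> / c)) \<in> borel_measurable M" by measurable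
  fix a :: real assume a: "a \<ge> 0"
  have "{\<omega> \<in> space M. sqrt (Q \<omega> / c) \<le> a} = Q -` {..c * a\<^sup>2} \<inter> space M"
    using a c nn by (auto simp: real_sqrt_le_iff' field_simps)
  then have "emeasure M {\<omega> \<in> space M. sqrt (Q \<omega> / c) \<le> a} = (\<integral>\<^sup>+x. ennreal (f x) * indicator {..c * a\<^sup>2} x \<partial>lborel)"
    using distributed_emeasure[OF Q] by simp
  also have "\<dots> = (\<integral>\<^sup>+x. ennreal (f x * indicator {c * 0\<^sup>2..c * a\<^sup>2} x) \<partial>lborel)"
    by (intro nn_integral_cong) (auto simp: indicator_def f0)
  also have "\<dots> = (\<integral>\<^sup>+v. ennreal (f (c * v\<^sup>2) * (c * (2 * v)) * indicator {0..a} v) \<partial>lborel)"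
    using a c by (intro nn_integral_substitution)
      (auto intro!: derivative_eq_intros continuous_intros simp: set_borel_measurable_def)
  also have "\<dots> = (\<integral>\<^sup>+v. ennreal (if v > 0 then f (c * v\<^sup>2) * 2 * c * v else 0) * indicator {0..a} v \<partial>lborel)"
    by (intro nn_integral_cong) (auto simp: indicator_def mult_ac)
  finally show "emeasure M {\<omega> \<in> space M. sqrt (Q \<omega> / c) \<le> a} = \<dots>" .
qed (use c f0 nn in auto)

text \<open>The whole mean sits in the coordinate \<open>i0\<close>. Every other square has shift 0,
  hence is central, and each convolution raises the degrees of freedom by one without changing the
  noncentrality.\<close>

lemma (in prob_space) distributed_sum_squares_std_normal:
  fixes X :: "'i \<Rightarrow> 'a \<Rightarrow> real"
  assumes "finite I" "i0 \<notin> I" "indep_vars (\<lambda>_. borel) X (insert i0 I)"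
    and X: "\<And>i. i \<in> insert i0 I \<Longrightarrow> distributed M lborel (X i) (\<lambda>x. ennreal (std_normal_density x))"
  shows "distributed M lborel (\<lambda>\<omega>. (X i0 \<omega> + g)\<^sup>2 + (\<Sum>i\<in>I. (X i \<omega>)\<^sup>2))
    (\<lambda>q. ennreal (ncchi2_density (1 + real (card I)) (g\<^sup>2) q))"
  using assms
proof (induction I rule: finite_induct)
  case empty
  then show ?case
    using distributed_square_shifted_std_normal[OF prob_space_axioms, of "X i0" g] by simp
next
  case (insert j J)
  \<comment> \<open>A single family for shifted and unshifted squares, so that one independence
    statement separates the new square from the sum of the old ones.\<close>
  define Y where "Y i \<omega> = (X i \<omega> + (if i = i0 then g else 0))\<^sup>2" for i \<omega>
  have sum_Y: "(\<Sum>i\<in>insert i0 J. Y i \<omega>) = (X i0 \<omega> + g)\<^sup>2 + (\<Sum>i\<in>J. (X i \<omega>)\<^sup>2)" for \<omega>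
    using insert.hyps insert.prems(1) by (auto simp: Y_def intro!: sum.cong)
  have Yj: "Y j = (\<lambda>\<omega>. (X j \<omega> + 0)\<^sup>2)"
    using insert.prems(1) by (auto simp: Y_def)
  have "indep_vars (\<lambda>_. borel) Y (insert j (insert i0 J))"
    unfolding Y_def
    by (rule indep_vars_compose2[where X = X and M' = "\<lambda>_. borel"])
       (simp_all only: insert_commute[of j] insert.prems(2), measurable)
  then have "indep_var borel (Y j) borel (\<lambda>\<omega>. \<Sum>i\<in>insert i0 J. Y i \<omega>)"
    by (rule indep_vars_sum[rotated 2]) (use insert.hyps insert.prems(1) in auto)
  from this[unfolded Yj sum_Y] have ind:
    "indep_var borel (\<lambda>\<omega>. (X j \<omega> + 0)\<^sup>2) borel (\<lambda>\<omega>. (X i0 \<omega> + g)\<^sup>2 + (\<Sum>i\<in>J. (X i \<omega>)\<^sup>2))" .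
  have "distributed M lborel (\<lambda>\<omega>. (X j \<omega> + 0)\<^sup>2 + ((X i0 \<omega> + g)\<^sup>2 + (\<Sum>i\<in>J. (X i \<omega>)\<^sup>2)))
    (\<lambda>x. \<integral>\<^sup>+y. ennreal (ncchi2_density 1 (0\<^sup>2) (x - y)) * ennreal (ncchi2_density (1 + real (card J)) (g\<^sup>2) y) \<partial>lborel)"
  proof (rule distributed_convolution[OF ind])
    show "distributed M lborel (\<lambda>\<omega>. (X j \<omega> + 0)\<^sup>2) (\<lambda>q. ennreal (ncchi2_density 1 (0\<^sup>2) q))"
      by (rule distributed_square_shifted_std_normal[OF prob_space_axioms insert.prems(3)]) simp
    show "distributed M lborel (\<lambda>\<omega>. (X i0 \<omega> + g)\<^sup>2 + (\<Sum>i\<in>J. (X i \<omega>)\<^sup>2)) (\<lambda>q. ennreal (ncchi2_density (1 + real (card J)) (g\<^sup>2) q))"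
    proof (rule insert.IH)
      show "i0 \<notin> J" using insert.prems(1) by simp
      show "indep_vars (\<lambda>_. borel) X (insert i0 J)"
        by (rule indep_vars_subset[OF insert.prems(2)]) auto
      show "distributed M lborel (X i) (\<lambda>x. ennreal (std_normal_density x))" if "i \<in> insert i0 J" for i
        using that by (intro insert.prems(3)) auto
    qed
  qed
  then show ?case
    using insert.hyps
    by (simp add: ncchi2_density_0 chi2_ncchi2_density_convolution algebra_simps)
qed

section \<open>Gamma integrals and the Student density\<close>

lemma nn_integral_powr_exp:
  assumes p: "p > 0" and b: "b > (0::real)"
  shows "(\<integral>\<^sup>+q. ennreal (q powr (p - 1) * exp (- (b * q))) * indicator {0<..} q \<partial>lborel) = ennreal (Gamma p / b powr p)"
proof -
  have "ennreal (Gamma p) = (\<integral>\<^sup>+t. ennreal (indicator {0..} t * t powr (p - 1) / exp t) \<partial>lborel)"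
    by (rule Gamma_conv_nn_integral_real[OF p])
  also have "\<dots> = ennreal b * (\<integral>\<^sup>+q. ennreal (indicator {0..} (b * q) * (b * q) powr (p - 1) / exp (b * q)) \<partial>lborel)"
    using b by (subst nn_integral_real_affine[where c = b and t = 0]) auto
  also have "(\<integral>\<^sup>+q. ennreal (indicator {0..} (b * q) * (b * q) powr (p - 1) / exp (b * q)) \<partial>lborel)
    = (\<integral>\<^sup>+q. ennreal (b powr (p - 1)) * (ennreal (q powr (p - 1) * exp (- (b * q))) * indicator {0<..} q) \<partial>lborel)"
    using b by (intro nn_integral_cong)
      (auto simp: indicator_def powr_mult exp_minus divide_inverse zero_le_mult_iff ennreal_mult[symmetric] mult_ac)
  also have "\<dots> = ennreal (b powr (p - 1)) * (\<integral>\<^sup>+q. ennreal (q powr (p - 1) * exp (- (b * q))) * indicator {0<..} q \<partial>lborel)"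
    by (subst nn_integral_cmult) auto
  finally have *: "ennreal (Gamma p) = ennreal (b powr p) * (\<integral>\<^sup>+q. ennreal (q powr (p - 1) * exp (- (b * q))) * indicator {0<..} q \<partial>lborel)"
    using b powr_add[of b 1 "p - 1"] by (simp add: mult.assoc[symmetric] ennreal_mult[symmetric])
  have "ennreal (1 / b powr p) * (ennreal (b powr p) * I) = I" for I
    using b by (simp add: mult.assoc[symmetric] ennreal_mult[symmetric])
  from this[of "\<integral>\<^sup>+q. ennreal (q powr (p - 1) * exp (- (b * q))) * indicator {0<..} q \<partial>lborel"]
  show ?thesis
    unfolding *[symmetric] using p by (simp add: ennreal_mult[symmetric])
qed

text \<open>With \<open>W = \<surd>(q / m)\<close> this says \<open>E (W * \<phi> (W * x))\<close> is the density of \<open>Z / W\<close>.\<close>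

lemma nn_integral_chi2_student:
  assumes m: "m > 0"
  shows "(\<integral>\<^sup>+q. ennreal (chi2_density m q) * ennreal (sqrt (q / m) * std_normal_density (sqrt (q / m) * x)) \<partial>lborel)
    = ennreal (student_t_density m x)"
proof -
  \<comment> \<open>The rate in \<open>q\<close> after merging the exponentials of the chi-squared
    and the normal density. The factor \<open>sqrt q\<close> raises the exponent of \<open>q\<close>
    to that of a Gamma integral with parameter \<open>(m + 1) / 2\<close>.\<close>
  define b where "b = (1 + x\<^sup>2 / m) / 2"
  have b: "b > 0" using m by (simp add: b_def add_pos_nonneg)
  define K where "K = 1 / (sqrt (2 * pi * m) * (2 powr (m / 2) * Gamma (m / 2)))"
  have K: "K \<ge> 0" using m by (simp add: K_def)
  have "(\<integral>\<^sup>+q. ennreal (chi2_density m q) * ennreal (sqrt (q / m) * std_normal_density (sqrt (q / m) * x)) \<partial>lborel)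
    = (\<integral>\<^sup>+q. ennreal K * (ennreal (q powr ((m + 1) / 2 - 1) * exp (- (b * q))) * indicator {0<..} q) \<partial>lborel)"
  proof (rule nn_integral_cong)
    fix q :: real
    show "ennreal (chi2_density m q) * ennreal (sqrt (q / m) * std_normal_density (sqrt (q / m) * x))
      = ennreal K * (ennreal (q powr ((m + 1) / 2 - 1) * exp (- (b * q))) * indicator {0<..} q)"
    proof (cases "q > 0")
      case True
      have "q powr ((m + 1) / 2 - 1) = q powr (m / 2 - 1) * sqrt q"
        using True by (simp add: powr_half_sqrt[symmetric] powr_add[symmetric] add_divide_distrib)
      moreover have "exp (- (b * q)) = exp (- q / 2) * exp (- (sqrt (q / m) * x)\<^sup>2 / 2)"
        using True m by (simp add: b_def exp_add[symmetric] power_mult_distrib field_simps)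
      ultimately have "chi2_density m q * (sqrt (q / m) * std_normal_density (sqrt (q / m) * x))
        = K * (q powr ((m + 1) / 2 - 1) * exp (- (b * q)))"
        using True m by (simp add: chi2_density_def std_normal_density_def K_def real_sqrt_divide real_sqrt_mult mult_ac)
      then show ?thesis
        using True m K by (simp add: ennreal_mult[symmetric] chi2_density_nonneg)
    qed (simp add: chi2_density_def)
  qed
  also have "\<dots> = ennreal (K * (Gamma ((m + 1) / 2) / b powr ((m + 1) / 2)))"
    using m b K by (subst nn_integral_cmult, measurable, subst nn_integral_powr_exp) (auto simp: ennreal_mult[symmetric])
  also have "K * (Gamma ((m + 1) / 2) / b powr ((m + 1) / 2)) = student_t_density m x"
  proof -
    have "b powr ((m + 1) / 2) = (1 + x\<^sup>2 / m) powr ((m + 1) / 2) / 2 powr ((m + 1) / 2)"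
      unfolding b_def using m by (intro powr_divide)
    moreover have "2 powr ((m + 1) / 2) = 2 powr (m / 2) * sqrt 2"
      by (simp add: add_divide_distrib powr_add powr_half_sqrt)
    moreover have "(1 + x\<^sup>2 / m) powr (- (m + 1) / 2) = 1 / (1 + x\<^sup>2 / m) powr ((m + 1) / 2)"
      using powr_minus_divide[of "1 + x\<^sup>2 / m" "(m + 1) / 2"] by (simp add: minus_divide_left)
    ultimately show ?thesis
      using m by (simp add: student_t_density_def K_def real_sqrt_mult)
  qed
  finally show ?thesis .
qed

section \<open>Coverage and length for independent normal and chi variables\<close>

lemma borel_measurable_student_t_density [measurable]: "student_t_density m \<in> borel_measurable borel"
  unfolding student_t_density_def[abs_def] by measurable

lemma Phi_properties:
  shows borel_measurable_Phi [measurable]: "Phi \<in> borel_measurable borel"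
    and Phi_nonneg: "0 \<le> Phi x" and Phi_le_1: "Phi x \<le> 1"
    and measure_std_normal_Icc: "y \<ge> 0 \<Longrightarrow>
      emeasure (density lborel (\<lambda>t. ennreal (std_normal_density t))) {- y..y} = ennreal (2 * Phi y - 1)"
    and Phi_ge_half: "y \<ge> 0 \<Longrightarrow> 2 * Phi y - 1 \<ge> 0"
proof -
  define N where "N = density lborel (\<lambda>t. ennreal (std_normal_density t))"
  interpret N: prob_space N unfolding N_def by (rule prob_space_normal_density) simp
  have sN[measurable_cong, simp]: "sets N = sets borel" by (simp add: N_def)
  have Phi: "Phi x = N.prob {..x}" for x by (simp add: Phi_def N_def)
  have "mono Phi" unfolding mono_def Phi by (auto intro!: N.finite_measure_mono)
  then show "Phi \<in> borel_measurable borel" by (rule borel_measurable_mono)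
  show "0 \<le> Phi x" "Phi x \<le> 1" by (simp_all add: Phi)
  assume y: "y \<ge> 0"
  have "emeasure N {..<- y} = (\<integral>\<^sup>+x. ennreal (std_normal_density x) * indicator {..<- y} x \<partial>lborel)"
    by (simp add: N_def emeasure_density)
  also have "\<dots> = (\<integral>\<^sup>+x. ennreal (std_normal_density x) * indicator {y<..} x \<partial>lborel)"
    by (subst nn_integral_real_affine[where c = "-1" and t = 0])
       (auto intro!: nn_integral_cong simp: indicator_def std_normal_density_def)
  also have "\<dots> = emeasure N {y<..}"
    by (simp add: N_def emeasure_density)
  finally have "N.prob {..<- y} = N.prob {y<..}" by (simp add: measure_def)
  also have "{y<..} = space N - {..y}" by (auto simp: N_def)
  also have "N.prob \<dots> = 1 - Phi y" unfolding Phi by (rule N.prob_compl) simp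
  finally have "N.prob {..<- y} = 1 - Phi y" .
  moreover have "{- y..y} = {..y} - {..<- y}" by auto
  moreover have "N.prob ({..y} - {..<- y}) = N.prob {..y} - N.prob {..<- y}"
    using y by (intro N.finite_measure_Diff) auto
  ultimately have "N.prob {- y..y} = 2 * Phi y - 1" by (simp add: Phi)
  then show "emeasure (density lborel (\<lambda>t. ennreal (std_normal_density t))) {- y..y} = ennreal (2 * Phi y - 1)"
    by (simp add: N_def[symmetric] N.emeasure_eq_measure)
  show "2 * Phi y - 1 \<ge> 0"
    unfolding \<open>N.prob {- y..y} = 2 * Phi y - 1\<close>[symmetric] by simp
qed

context prob_space
begin

text \<open>Independence makes the joint law a product, which is sliced at fixed \<open>U\<close>.
  The slice is kept as a normal measure, not yet expressed by \<open>Phi\<close>, because it is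
  needed both for the \<open>Phi\<close> formula and for the passage to the Student density.\<close>

lemma emeasure_abs_std_normal_le_indep:
  assumes Z: "distributed M lborel Z (\<lambda>x. ennreal (std_normal_density x))"
    and ind: "indep_var borel Z borel U"
  shows "emeasure M {\<omega> \<in> space M. \<bar>Z \<omega>\<bar> \<le> U \<omega>}
    = (\<integral>\<^sup>+\<omega>. emeasure (density lborel (\<lambda>t. ennreal (std_normal_density t))) {- U \<omega>..U \<omega>} \<partial>M)"
proof -
  let ?N = "density lborel (\<lambda>t. ennreal (std_normal_density t))"
  have [measurable]: "Z \<in> borel_measurable M" "U \<in> borel_measurable M"
    using ind by (auto dest: indep_var_rv1 indep_var_rv2)
  have dZ: "distr M borel Z = ?N"
    using distributed_distr_eq_density[OF Z] by (simp add: distr_def cong: distr_cong)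
  interpret dU: prob_space "distr M borel U" by (rule prob_space_distr) simp
  interpret N: prob_space ?N by (rule prob_space_normal_density) simp
  interpret P: pair_sigma_finite ?N "distr M borel U" ..
  let ?A = "{p \<in> space (?N \<Otimes>\<^sub>M distr M borel U). \<bar>fst p\<bar> \<le> snd p}"
  have A: "?A \<in> sets (?N \<Otimes>\<^sub>M distr M borel U)" by measurable
  have "emeasure M {\<omega> \<in> space M. \<bar>Z \<omega>\<bar> \<le> U \<omega>} = emeasure (distr M (borel \<Otimes>\<^sub>M borel) (\<lambda>\<omega>. (Z \<omega>, U \<omega>))) ?A"
    using A by (subst emeasure_distr) (auto simp: space_pair_measure intro!: arg_cong[where f = "emeasure M"])
  also have "distr M (borel \<Otimes>\<^sub>M borel) (\<lambda>\<omega>. (Z \<omega>, U \<omega>)) = ?N \<Otimes>\<^sub>M distr M borel U"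
    using ind unfolding indep_var_distribution_eq dZ by simp
  also have "emeasure (?N \<Otimes>\<^sub>M distr M borel U) ?A = (\<integral>\<^sup>+u. emeasure ?N ((\<lambda>x. (x, u)) -` ?A) \<partial>distr M borel U)"
    by (rule P.emeasure_pair_measure_alt2[OF A])
  also have "\<dots> = (\<integral>\<^sup>+u. emeasure ?N {- u..u} \<partial>distr M borel U)"
    by (intro nn_integral_cong arg_cong[where f = "emeasure ?N"]) (auto simp: space_pair_measure)
  also have "\<dots> = (\<integral>\<^sup>+\<omega>. emeasure ?N {- U \<omega>..U \<omega>} \<partial>M)"
  proof -
    have "(\<lambda>x. (x, u)) -` ?A = {- u..u}" for u
      by (auto simp: space_pair_measure)
    then have "(\<lambda>u. emeasure ?N {- u..u}) \<in> borel_measurable (distr M borel U)"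
      using P.measurable_emeasure_Pair2[OF A] by simp
    then show ?thesis by (subst nn_integral_distr) auto
  qed
  finally show ?thesis .
qed

lemma prob_abs_std_normal_le_indep:
  assumes Z: "distributed M lborel Z (\<lambda>x. ennreal (std_normal_density x))"
    and ind: "indep_var borel Z borel U" and U: "\<And>\<omega>. \<omega> \<in> space M \<Longrightarrow> U \<omega> \<ge> 0"
  shows "prob {\<omega> \<in> space M. \<bar>Z \<omega>\<bar> \<le> U \<omega>} = expectation (\<lambda>\<omega>. 2 * Phi (U \<omega>) - 1)"
proof -
  have [measurable]: "U \<in> borel_measurable M"
    using ind by (auto dest: indep_var_rv2)
  have bound: "AE \<omega> in M. norm (2 * Phi (U \<omega>) - 1) \<le> 1"
    using Phi_nonneg Phi_le_1 by (intro AE_I2) (simp add: abs_le_iff)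
  have int: "integrable M (\<lambda>\<omega>. 2 * Phi (U \<omega>) - 1)"
    by (rule integrable_const_bound[OF bound]) simp
  have "ennreal (prob {\<omega> \<in> space M. \<bar>Z \<omega>\<bar> \<le> U \<omega>}) = (\<integral>\<^sup>+\<omega>. ennreal (2 * Phi (U \<omega>) - 1) \<partial>M)"
    unfolding emeasure_eq_measure[symmetric] emeasure_abs_std_normal_le_indep[OF Z ind]
    using U by (intro nn_integral_cong measure_std_normal_Icc)
  also have "\<dots> = ennreal (expectation (\<lambda>\<omega>. 2 * Phi (U \<omega>) - 1))"
    using U by (intro nn_integral_eq_integral[OF int] AE_I2 Phi_ge_half)
  finally show ?thesis
    using U by (subst (asm) ennreal_inj) (auto intro!: integral_nonneg_AE AE_I2 Phi_ge_half)
qed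

text \<open>Rescaling each normal slice by \<open>W\<close> moves the randomness from the bounds
  into the integrand; the two integrals can then be exchanged and the inner one is the Student
  density.\<close>

lemma prob_abs_std_normal_le_scaled_chi:
  assumes Z: "distributed M lborel Z (\<lambda>x. ennreal (std_normal_density x))"
    and R: "distributed M lborel R (\<lambda>x. ennreal (chi2_density m x))"
    and R0: "\<And>\<omega>. \<omega> \<in> space M \<Longrightarrow> R \<omega> \<ge> 0" and m: "m > 0" and c: "c > 0"
    and ind: "indep_var borel Z borel (\<lambda>\<omega>. sqrt (R \<omega> / m) * c)"
  shows "prob {\<omega> \<in> space M. \<bar>Z \<omega>\<bar> \<le> sqrt (R \<omega> / m) * c} = set_lebesgue_integral lborel {-c..c} (student_t_density m)"
proof -
  have [measurable]: "R \<in> borel_measurable M" using distributed_measurable[OF R] by simp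
  let ?p = "\<lambda>x. ennreal (std_normal_density x)"
  define W where "W \<omega> = sqrt (R \<omega> / m)" for \<omega>
  have W0: "W \<omega> \<ge> 0" if "\<omega> \<in> space M" for \<omega> using R0[OF that] m by (simp add: W_def)
  have [measurable]: "W \<in> borel_measurable M" unfolding W_def by measurable
  have "emeasure M {\<omega> \<in> space M. \<bar>Z \<omega>\<bar> \<le> W \<omega> * c} = (\<integral>\<^sup>+\<omega>. emeasure (density lborel ?p) {- (W \<omega> * c)..W \<omega> * c} \<partial>M)"
    using emeasure_abs_std_normal_le_indep[OF Z ind] by (simp add: W_def)
  also have "\<dots> = (\<integral>\<^sup>+\<omega>. (\<integral>\<^sup>+x. ennreal (W \<omega>) * ?p (W \<omega> * x) * indicator {-c..c} x \<partial>lborel) \<partial>M)"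
  proof (rule nn_integral_cong)
    fix \<omega> assume \<omega>: "\<omega> \<in> space M"
    show "emeasure (density lborel ?p) {- (W \<omega> * c)..W \<omega> * c} = (\<integral>\<^sup>+x. ennreal (W \<omega>) * ?p (W \<omega> * x) * indicator {-c..c} x \<partial>lborel)"
    proof (cases "W \<omega> = 0")
      \<comment> \<open>The slice is the single point 0 and hence null, while on the other side the
        factor \<open>W \<omega>\<close> vanishes.\<close>
      case True
      then show ?thesis
        by (simp add: emeasure_density)
    next
      case False
      then have w: "W \<omega> > 0" using W0[OF \<omega>] by simp
      have "emeasure (density lborel ?p) {- (W \<omega> * c)..W \<omega> * c} = (\<integral>\<^sup>+x. ?p x * indicator {- (W \<omega> * c)..W \<omega> * c} x \<partial>lborel)"
        by (simp add: emeasure_density)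
      also have "\<dots> = ennreal (W \<omega>) * (\<integral>\<^sup>+x. ?p (W \<omega> * x) * indicator {- (W \<omega> * c)..W \<omega> * c} (W \<omega> * x) \<partial>lborel)"
        using w by (subst nn_integral_real_affine[where c = "W \<omega>" and t = 0]) auto
      also have "\<dots> = (\<integral>\<^sup>+x. ennreal (W \<omega>) * (?p (W \<omega> * x) * indicator {- (W \<omega> * c)..W \<omega> * c} (W \<omega> * x)) \<partial>lborel)"
        by (rule nn_integral_cmult[symmetric]) auto
      also have "\<dots> = (\<integral>\<^sup>+x. ennreal (W \<omega>) * ?p (W \<omega> * x) * indicator {-c..c} x \<partial>lborel)"
      proof (rule nn_integral_cong)
        fix x
        have "- (W \<omega> * c) \<le> W \<omega> * x \<longleftrightarrow> - c \<le> x" "W \<omega> * x \<le> W \<omega> * c \<longleftrightarrow> x \<le> c"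
          using w mult_le_cancel_left_pos[of "W \<omega>" "- c" x] by auto
        then show "ennreal (W \<omega>) * (?p (W \<omega> * x) * indicator {- (W \<omega> * c)..W \<omega> * c} (W \<omega> * x))
          = ennreal (W \<omega>) * ?p (W \<omega> * x) * indicator {-c..c} x"
          by (simp add: indicator_def)
      qed
      finally show ?thesis .
    qed
  qed
  also have "\<dots> = (\<integral>\<^sup>+x. (\<integral>\<^sup>+\<omega>. ennreal (W \<omega>) * ?p (W \<omega> * x) * indicator {-c..c} x \<partial>M) \<partial>lborel)"
  proof -
    interpret pair_sigma_finite M lborel ..
    show ?thesis by (rule Fubini'[symmetric]) measurable
  qed
  also have "\<dots> = (\<integral>\<^sup>+x. ennreal (student_t_density m x * indicator {-c..c} x) \<partial>lborel)"
  proof (rule nn_integral_cong)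
    fix x
    have "(\<integral>\<^sup>+\<omega>. ennreal (W \<omega>) * ?p (W \<omega> * x) \<partial>M) = (\<integral>\<^sup>+\<omega>. ennreal (sqrt (R \<omega> / m) * std_normal_density (sqrt (R \<omega> / m) * x)) \<partial>M)"
      using W0 by (intro nn_integral_cong) (simp add: W_def ennreal_mult[symmetric])
    also have "\<dots> = (\<integral>\<^sup>+q. ennreal (chi2_density m q) * ennreal (sqrt (q / m) * std_normal_density (sqrt (q / m) * x)) \<partial>lborel)"
      by (rule distributed_nn_integral[OF R, symmetric]) measurable
    also have "\<dots> = ennreal (student_t_density m x)"
      by (rule nn_integral_chi2_student[OF m])
    finally show "(\<integral>\<^sup>+\<omega>. ennreal (W \<omega>) * ?p (W \<omega> * x) * indicator {-c..c} x \<partial>M) = ennreal (student_t_density m x * indicator {-c..c} x)"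
      by (subst nn_integral_multc) (auto simp: indicator_def)
  qed
  finally have *: "ennreal (prob {\<omega> \<in> space M. \<bar>Z \<omega>\<bar> \<le> W \<omega> * c}) = (\<integral>\<^sup>+x. ennreal (student_t_density m x * indicator {-c..c} x) \<partial>lborel)"
    by (simp add: emeasure_eq_measure)
  have "student_t_density m x \<ge> 0" for x
    using m by (simp add: student_t_density_def)
  then have "set_lebesgue_integral lborel {-c..c} (student_t_density m) = enn2real (\<integral>\<^sup>+x. ennreal (student_t_density m x * indicator {-c..c} x) \<partial>lborel)"
    unfolding set_lebesgue_integral_def
    by (subst integral_eq_nn_integral) (auto simp: mult.commute)
  then show ?thesis
    unfolding *[symmetric] by (simp add: W_def)
qed

text \<open>At 0 the Student density equals the expectation of the scaled root times the normal
  density at 0; since that value is finite and positive, so is the expectation.\<close>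

lemma integrable_sqrt_chi2:
  assumes R: "distributed M lborel R (\<lambda>x. ennreal (chi2_density m x))"
    and R0: "\<And>\<omega>. \<omega> \<in> space M \<Longrightarrow> R \<omega> \<ge> 0" and m: "m > 0"
  shows "integrable M (\<lambda>\<omega>. sqrt (R \<omega> / m))" and "expectation (\<lambda>\<omega>. sqrt (R \<omega> / m)) > 0"
proof -
  have [measurable]: "R \<in> borel_measurable M" using distributed_measurable[OF R] by simp
  define c where "c = std_normal_density 0"
  have c: "c > 0" by (simp add: c_def normal_density_pos)
  have st: "student_t_density m 0 > 0"
    using m by (simp add: student_t_density_def)
  have "(\<integral>\<^sup>+\<omega>. ennreal (sqrt (R \<omega> / m) * c) \<partial>M) = (\<integral>\<^sup>+q. ennreal (chi2_density m q) * ennreal (sqrt (q / m) * c) \<partial>lborel)"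
    by (rule distributed_nn_integral[OF R, symmetric]) measurable
  also have "\<dots> = ennreal (student_t_density m 0)"
    using nn_integral_chi2_student[OF m, of 0] by (simp add: c_def)
  finally have "has_bochner_integral M (\<lambda>\<omega>. sqrt (R \<omega> / m) * c) (student_t_density m 0)"
    using R0 m c st by (intro has_bochner_integral_nn_integral) (auto intro!: AE_I2)
  from has_bochner_integral_divide_zero[OF this, of c]
  have "has_bochner_integral M (\<lambda>\<omega>. sqrt (R \<omega> / m)) (student_t_density m 0 / c)"
    using c by simp
  then show "integrable M (\<lambda>\<omega>. sqrt (R \<omega> / m))" "expectation (\<lambda>\<omega>. sqrt (R \<omega> / m)) > 0"
    using st c by (auto simp: has_bochner_integral_iff)
qed

text \<open>For fixed \<open>w > 0\<close> the substitution \<open>v = x * w\<close> has Jacobian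
  \<open>w\<close>; for \<open>w \<le> 0\<close> both sides vanish with \<open>fw\<close>.\<close>

lemma distributed_ratio:
  assumes V: "distributed M lborel V (\<lambda>x. ennreal (fv x))" and W: "distributed M lborel W (\<lambda>x. ennreal (fw x))"
    and ind: "indep_var borel V borel W"
    and [measurable]: "fv \<in> borel_measurable borel" "fw \<in> borel_measurable borel"
    and nn: "\<And>x. fv x \<ge> 0" "\<And>x. fw x \<ge> 0" and fw0: "\<And>x. x \<le> 0 \<Longrightarrow> fw x = 0"
  shows "distributed M (lborel \<Otimes>\<^sub>M lborel) (\<lambda>\<omega>. (V \<omega> / W \<omega>, W \<omega>)) (\<lambda>p. ennreal (fv (fst p * snd p) * snd p * fw (snd p)))"
proof -
  have ind': "indep_var lborel V lborel W"
    using ind by (simp add: indep_var_eq)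
  have VW: "distributed M (lborel \<Otimes>\<^sub>M lborel) (\<lambda>\<omega>. (V \<omega>, W \<omega>)) (\<lambda>(v, w). ennreal (fv v) * ennreal (fw w))"
    by (rule distributed_joint_indep[OF _ _ V W ind']) (auto intro: lborel.sigma_finite_measure_axioms)
  have [measurable]: "V \<in> borel_measurable M" "W \<in> borel_measurable M"
    using ind by (auto dest: indep_var_rv1 indep_var_rv2)
  let ?L = "lborel \<Otimes>\<^sub>M lborel :: (real \<times> real) measure"
  show ?thesis
    unfolding distributed_def
  proof (intro conjI measure_eqI)
    fix A assume "A \<in> sets (distr M ?L (\<lambda>\<omega>. (V \<omega> / W \<omega>, W \<omega>)))"
    then have A[measurable]: "A \<in> sets (borel \<Otimes>\<^sub>M borel)" by simp
    have "emeasure (distr M ?L (\<lambda>\<omega>. (V \<omega> / W \<omega>, W \<omega>))) A = (\<integral>\<^sup>+\<omega>. indicator A (V \<omega> / W \<omega>, W \<omega>) \<partial>M)"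
      by (subst nn_integral_indicator[symmetric], simp, subst nn_integral_distr) auto
    also have "\<dots> = (\<integral>\<^sup>+p. (\<lambda>(v, w). ennreal (fv v) * ennreal (fw w)) p * indicator A (fst p / snd p, snd p) \<partial>?L)"
      by (subst distributed_nn_integral[OF VW]) auto
    also have "\<dots> = (\<integral>\<^sup>+w. (\<integral>\<^sup>+v. ennreal (fv v) * ennreal (fw w) * indicator A (v / w, w) \<partial>lborel) \<partial>lborel)"
      by (subst lborel_pair.nn_integral_snd[symmetric]) auto
    also have "\<dots> = (\<integral>\<^sup>+w. (\<integral>\<^sup>+x. ennreal (fv (x * w) * w * fw w) * indicator A (x, w) \<partial>lborel) \<partial>lborel)"
    proof (rule nn_integral_cong)
      fix w :: real
      show "(\<integral>\<^sup>+v. ennreal (fv v) * ennreal (fw w) * indicator A (v / w, w) \<partial>lborel)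
        = (\<integral>\<^sup>+x. ennreal (fv (x * w) * w * fw w) * indicator A (x, w) \<partial>lborel)"
      proof (cases "w > 0")
        case True
        then have "(\<integral>\<^sup>+v. ennreal (fv v) * ennreal (fw w) * indicator A (v / w, w) \<partial>lborel)
          = ennreal w * (\<integral>\<^sup>+x. ennreal (fv (w * x)) * ennreal (fw w) * indicator A (x, w) \<partial>lborel)"
          by (subst nn_integral_real_affine[where c = w and t = 0]) auto
        also have "\<dots> = (\<integral>\<^sup>+x. ennreal w * (ennreal (fv (w * x)) * ennreal (fw w) * indicator A (x, w)) \<partial>lborel)"
          by (subst nn_integral_cmult) auto
        also have "\<dots> = (\<integral>\<^sup>+x. ennreal (fv (x * w) * w * fw w) * indicator A (x, w) \<partial>lborel)"
          using True nn by (intro nn_integral_cong) (simp add: ennreal_mult mult_ac)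
        finally show ?thesis .
      qed (simp add: fw0)
    qed
    also have "\<dots> = emeasure (density ?L (\<lambda>p. ennreal (fv (fst p * snd p) * snd p * fw (snd p)))) A"
      by (subst emeasure_density) (auto simp: lborel_pair.nn_integral_snd[symmetric])
    finally show "emeasure (distr M ?L (\<lambda>\<omega>. (V \<omega> / W \<omega>, W \<omega>))) A = \<dots>" .
  qed auto
qed

text \<open>Integrability of the composed variable passes to the plane, so Fubini applies in either
  order: coverage uses \<open>x\<close> as the outer variable, expected length uses
  \<open>w\<close>.\<close>

lemma expectation_ratio:
  fixes H :: "real \<Rightarrow> real \<Rightarrow> real"
  assumes V: "distributed M lborel V (\<lambda>x. ennreal (fv x))" and W: "distributed M lborel W (\<lambda>x. ennreal (fw x))"
    and ind: "indep_var borel V borel W"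
    and mf: "fv \<in> borel_measurable borel" "fw \<in> borel_measurable borel"
    and nn: "\<And>x. fv x \<ge> 0" "\<And>x. fw x \<ge> 0"
    and f0: "\<And>x. x \<le> 0 \<Longrightarrow> fv x = 0" "\<And>x. x \<le> 0 \<Longrightarrow> fw x = 0"
    and H[measurable]: "(\<lambda>p. H (fst p) (snd p)) \<in> borel_measurable (borel \<Otimes>\<^sub>M borel)"
    and H0: "\<And>x w. x \<ge> k \<Longrightarrow> H x w = 0" and k: "k > 0"
    and int: "integrable M (\<lambda>\<omega>. H (V \<omega> / W \<omega>) (W \<omega>))"
  shows "expectation (\<lambda>\<omega>. H (V \<omega> / W \<omega>) (W \<omega>)) = (LBINT x=0..k. (LBINT w=0..\<infinity>. H x w * fv (x * w) * w * fw w))"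
    and "expectation (\<lambda>\<omega>. H (V \<omega> / W \<omega>) (W \<omega>)) = (LBINT w=0..\<infinity>. (LBINT x=0..k. H x w * fv (x * w) * w * fw w))"
proof -
  let ?L = "lborel \<Otimes>\<^sub>M lborel :: (real \<times> real) measure"
  let ?P = "\<lambda>p. fv (fst p * snd p) * snd p * fw (snd p)"
  let ?G = "\<lambda>x w. H x w * fv (x * w) * w * fw w"
  have D: "distributed M ?L (\<lambda>\<omega>. (V \<omega> / W \<omega>, W \<omega>)) (\<lambda>p. ennreal (?P p))"
    by (rule distributed_ratio[OF V W ind mf nn f0(2)])
  have P0: "?P p \<ge> 0" for p
    using nn f0(2)[of "snd p"] by (cases "snd p \<le> 0") auto
  have HP: "(\<lambda>p. ?P p * H (fst p) (snd p)) = (\<lambda>(x, w). indicator {0<..<k} x * (indicator {0<..} w * ?G x w))"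
  proof (rule ext)
    fix p :: "real \<times> real"
    obtain x w where p: "p = (x, w)" by (cases p)
    show "?P p * H (fst p) (snd p) = (\<lambda>(x, w). indicator {0<..<k} x * (indicator {0<..} w * ?G x w)) p"
    proof (cases "w > 0 \<and> x > 0 \<and> x < k")
      case False
      \<comment> \<open>Outside the region one factor vanishes in each case: the density of
        \<open>W\<close>, the density of \<open>V\<close>, or \<open>H\<close>.\<close>
      then consider "w \<le> 0" | "w > 0" "x \<le> 0" | "x \<ge> k" by linarith
      then show ?thesis
      proof cases
        case 2
        then have "x * w \<le> 0" by (simp add: mult_nonpos_nonneg)
        then show ?thesis by (simp add: p f0)
      qed (simp_all add: p f0 H0)
    qed (simp add: p)
  qed
  have "integrable ?L (\<lambda>p. ?P p * H (fst p) (snd p))"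
    using int by (subst distributed_integrable[OF D _ P0]) auto
  then have I: "integrable ?L (\<lambda>(x, w). indicator {0<..<k} x * (indicator {0<..} w * ?G x w))"
    unfolding HP .
  have "expectation (\<lambda>\<omega>. H (V \<omega> / W \<omega>) (W \<omega>)) = (\<integral>p. ?P p * H (fst p) (snd p) \<partial>?L)"
    by (subst distributed_integral[OF D _ P0]) auto
  then have E: "expectation (\<lambda>\<omega>. H (V \<omega> / W \<omega>) (W \<omega>)) = (\<integral>(x, w). indicator {0<..<k} x * (indicator {0<..} w * ?G x w) \<partial>?L)"
    unfolding HP .
  have ioo: "(LBINT x=0..k. f x) = (\<integral>x. indicator {0<..<k} x * f x \<partial>lborel)" for f :: "real \<Rightarrow> real"
    using k by (simp add: interval_lebesgue_integral_def set_lebesgue_integral_def zero_ereal_def)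
  have ioi: "(LBINT x=0..\<infinity>. f x) = (\<integral>x. indicator {0<..} x * f x \<partial>lborel)" for f :: "real \<Rightarrow> real"
    by (simp add: zero_ereal_def interval_integral_to_infinity_eq set_lebesgue_integral_def)
  show "expectation (\<lambda>\<omega>. H (V \<omega> / W \<omega>) (W \<omega>)) = (LBINT x=0..k. (LBINT w=0..\<infinity>. ?G x w))"
    unfolding E ioo ioi by (subst lborel_pair.integral_fst[OF I, symmetric]) simp
  show "expectation (\<lambda>\<omega>. H (V \<omega> / W \<omega>) (W \<omega>)) = (LBINT w=0..\<infinity>. (LBINT x=0..k. ?G x w))"
    unfolding E ioo ioi by (subst lborel_pair.integral_snd[OF I, symmetric]) (simp add: mult.left_commute)
qed

text \<open>The probabilistic core, free of regression. Independence of \<open>Z\<close> is assumed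
  against real functions of the pair \<open>(Q, R)\<close>, because it is applied to two of them:
  the bound with \<open>d\<close> and the reference bound with \<open>tm\<close>.\<close>

lemma coverage_and_expected_length:
  fixes Z Q R :: "'a \<Rightarrow> real" and d :: "real \<Rightarrow> real" and s m g k tm :: real
  defines "V \<equiv> \<lambda>\<omega>. sqrt (Q \<omega> / s)" and "W \<equiv> \<lambda>\<omega>. sqrt (R \<omega> / m)"
  assumes Z: "distributed M lborel Z (\<lambda>x. ennreal (std_normal_density x))"
    and Q: "distributed M lborel Q (\<lambda>x. ennreal (ncchi2_density s (g\<^sup>2) x))" "\<And>\<omega>. \<omega> \<in> space M \<Longrightarrow> Q \<omega> \<ge> 0"
    and R: "distributed M lborel R (\<lambda>x. ennreal (chi2_density m x))" "\<And>\<omega>. \<omega> \<in> space M \<Longrightarrow> R \<omega> \<ge> 0"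
    and s: "s > 0" and m: "m > 0"
    and indQR: "indep_var borel Q borel R"
    and indZ: "\<And>h. h \<in> borel_measurable (borel \<Otimes>\<^sub>M borel) \<Longrightarrow> indep_var borel Z borel (\<lambda>\<omega>. h (Q \<omega>, R \<omega>))"
    and d: "continuous_on {0..} d" "\<And>x. x \<ge> 0 \<Longrightarrow> d x > 0" "\<And>x. x \<ge> k \<Longrightarrow> d x = tm"
    and k: "k > 0" and tm: "tm > 0"
  shows "prob {\<omega> \<in> space M. \<bar>Z \<omega>\<bar> \<le> W \<omega> * d (V \<omega> / W \<omega>)} =
      set_lebesgue_integral lborel {-tm..tm} (student_t_density m) +
      2 * (LBINT x=0..k. (LBINT w=0..\<infinity>. (Phi (w * d x) - Phi (w * tm)) * fV s g (x * w) * w * fW m w))"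
    and "expectation (\<lambda>\<omega>. W \<omega> * d (V \<omega> / W \<omega>)) =
      tm * expectation W + (LBINT w=0..\<infinity>. (LBINT x=0..k. (d x - tm) * fV s g (x * w)) * w\<^sup>2 * fW m w)"
    and "expectation W > 0"
proof -
  have [measurable]: "Z \<in> borel_measurable M" "Q \<in> borel_measurable M" "R \<in> borel_measurable M"
    using distributed_measurable[OF Z] distributed_measurable[OF Q(1)] distributed_measurable[OF R(1)] by simp_all
  have [measurable]: "V \<in> borel_measurable M" "W \<in> borel_measurable M"
    unfolding V_def W_def by measurable
  have V0: "V \<omega> \<ge> 0" and W0: "W \<omega> \<ge> 0" if "\<omega> \<in> space M" for \<omega>
    using Q(2)[OF that] R(2)[OF that] s m by (simp_all add: V_def W_def)
  have dV: "distributed M lborel V (\<lambda>x. ennreal (fV s g x))"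
    unfolding V_def fV_def using s
    by (intro distributed_sqrt_divide[OF prob_space_axioms Q(1)])
       (auto simp: ncchi2_density_nonneg ncchi2_density_nonpos Q(2))
  have dW: "distributed M lborel W (\<lambda>x. ennreal (fW m x))"
    unfolding W_def fW_def using m
    by (intro distributed_sqrt_divide[OF prob_space_axioms R(1)])
       (auto simp: chi2_density_nonneg chi2_density_def[of _ "_ :: real"] R(2))
  have mf: "fV s g \<in> borel_measurable borel" "fW m \<in> borel_measurable borel"
    unfolding fV_def[abs_def] fW_def[abs_def] by measurable
  have nn: "fV s g x \<ge> 0" "fW m x \<ge> 0" for x
    using s m by (simp_all add: fV_def fW_def ncchi2_density_nonneg chi2_density_nonneg)
  have f0: "fV s g x = 0" "fW m x = 0" if "x \<le> 0" for x
    using that by (simp_all add: fV_def fW_def)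
  have indVW: "indep_var borel V borel W"
    using indep_var_compose[OF indQR, of "\<lambda>q. sqrt (q / s)" borel "\<lambda>r. sqrt (r / m)" borel]
    by (simp add: comp_def V_def W_def)
  \<comment> \<open>\<open>d\<close> is controlled only on the nonnegative half-line. Extending it
    constantly to the left gives a function continuous, hence measurable, on the whole line.\<close>
  define D where "D x = d (max 0 x)" for x
  have "continuous_on UNIV D"
    unfolding D_def by (rule continuous_on_compose2[OF d(1)]) (auto intro!: continuous_intros)
  then have D[measurable]: "D \<in> borel_measurable borel"
    by (rule borel_measurable_continuous_onI)
  have Dd: "D x = d x" if "x \<ge> 0" for x using that by (simp add: D_def max_def)
  have Dk: "D x = tm" if "x \<ge> k" for x using that k d(3)[OF that] by (simp add: Dd)
  have Dpos: "D x > 0" for x using d(2)[of "max 0 x"] by (simp add: D_def)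
  \<comment> \<open>Compactness bounds \<open>d\<close> up to \<open>k\<close>, and beyond
    \<open>k\<close> it is constant. With integrability of \<open>W\<close> this makes the expected
    length finite.\<close>
  obtain B where B: "\<bar>D x\<bar> \<le> B" for x
  proof -
    have "compact (d ` {0..k})"
      using continuous_on_subset[OF d(1)] by (intro compact_continuous_image) auto
    then have "\<exists>B. \<forall>x\<in>{0..k}. \<bar>d x\<bar> \<le> B"
      by (auto dest!: compact_imp_bounded simp: bounded_iff)
    then obtain B where B: "\<And>x. x \<in> {0..k} \<Longrightarrow> \<bar>d x\<bar> \<le> B"
      by blast
    have "\<bar>D x\<bar> \<le> max B tm" for x
    proof (cases "x \<ge> k")
      case False
      then have "max 0 x \<in> {0..k}" using k by auto
      then show ?thesis using B[of "max 0 x"] by (simp add: D_def max.coboundedI1)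
    qed (use tm Dk in auto)
    then show thesis by (rule that)
  qed
  \<comment> \<open>The ratio is nonnegative also when \<open>W \<omega> = 0\<close>, where it is
    0.\<close>
  have DVW: "d (V \<omega> / W \<omega>) = D (V \<omega> / W \<omega>)" if "\<omega> \<in> space M" for \<omega>
    using V0[OF that] W0[OF that] by (simp add: Dd)
  define U where "U \<omega> = W \<omega> * D (V \<omega> / W \<omega>)" for \<omega>
  have [measurable]: "U \<in> borel_measurable M" unfolding U_def by measurable
  have U0: "U \<omega> \<ge> 0" if "\<omega> \<in> space M" for \<omega>
    using W0[OF that] Dpos[of "V \<omega> / W \<omega>"] by (simp add: U_def)
  have indZU: "indep_var borel Z borel U"
    using indZ[of "\<lambda>p. sqrt (snd p / m) * D (sqrt (fst p / s) / sqrt (snd p / m))"]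
    by (simp add: U_def[abs_def] V_def W_def)
  have indZW: "indep_var borel Z borel (\<lambda>\<omega>. W \<omega> * tm)"
    using indZ[of "\<lambda>p. sqrt (snd p / m) * tm"] by (simp add: W_def)
  have Phi_int: "integrable M (\<lambda>\<omega>. Phi (f \<omega>))" if [measurable]: "f \<in> borel_measurable M" for f
    by (rule integrable_const_bound[where B = 1]) (auto simp: Phi_nonneg Phi_le_1)
  have PU: "integrable M (\<lambda>\<omega>. Phi (U \<omega>))" and PW: "integrable M (\<lambda>\<omega>. Phi (W \<omega> * tm))"
    by (intro Phi_int; measurable)+
  have int_W: "integrable M W" and EW: "expectation W > 0"
    unfolding W_def using integrable_sqrt_chi2[OF R m] by auto
  then show "expectation W > 0" by simp
  have "prob {\<omega> \<in> space M. \<bar>Z \<omega>\<bar> \<le> W \<omega> * d (V \<omega> / W \<omega>)} = prob {\<omega> \<in> space M. \<bar>Z \<omega>\<bar> \<le> U \<omega>}"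
    by (intro arg_cong[where f = prob] Collect_cong) (auto simp: U_def DVW)
  also have "\<dots> = expectation (\<lambda>\<omega>. 2 * Phi (U \<omega>) - 1)"
    by (rule prob_abs_std_normal_le_indep[OF Z indZU U0])
  \<comment> \<open>Splitting off the reference interval leaves an integrand that vanishes once the
    ratio reaches \<open>k\<close>, as \<open>expectation_ratio\<close> demands.\<close>
  also have "\<dots> = expectation (\<lambda>\<omega>. (2 * Phi (W \<omega> * tm) - 1) + 2 * (Phi (U \<omega>) - Phi (W \<omega> * tm)))"
    by (intro Bochner_Integration.integral_cong) auto
  also have "\<dots> = expectation (\<lambda>\<omega>. 2 * Phi (W \<omega> * tm) - 1) + 2 * expectation (\<lambda>\<omega>. Phi (U \<omega>) - Phi (W \<omega> * tm))"
    by (simp add: PU PW)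
  also have "expectation (\<lambda>\<omega>. 2 * Phi (W \<omega> * tm) - 1) = prob {\<omega> \<in> space M. \<bar>Z \<omega>\<bar> \<le> W \<omega> * tm}"
    using W0 tm by (intro prob_abs_std_normal_le_indep[OF Z indZW, symmetric]) auto
  also have "\<dots> = set_lebesgue_integral lborel {-tm..tm} (student_t_density m)"
    using prob_abs_std_normal_le_scaled_chi[OF Z R m tm] indZW by (simp add: W_def)
  also have "expectation (\<lambda>\<omega>. Phi (U \<omega>) - Phi (W \<omega> * tm))
    = expectation (\<lambda>\<omega>. (\<lambda>x w. Phi (w * D x) - Phi (w * tm)) (V \<omega> / W \<omega>) (W \<omega>))"
    by (simp add: U_def)
  also have "\<dots> = (LBINT x=0..k. (LBINT w=0..\<infinity>. (Phi (w * D x) - Phi (w * tm)) * fV s g (x * w) * w * fW m w))"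
  proof (rule expectation_ratio(1)[OF dV dW indVW mf nn f0 _ _ k])
    show "integrable M (\<lambda>\<omega>. Phi (W \<omega> * D (V \<omega> / W \<omega>)) - Phi (W \<omega> * tm))"
      by (intro Bochner_Integration.integrable_diff Phi_int) measurable
  qed (auto simp: Dk)
  also have "\<dots> = (LBINT x=0..k. (LBINT w=0..\<infinity>. (Phi (w * d x) - Phi (w * tm)) * fV s g (x * w) * w * fW m w))"
    using k by (intro interval_integral_cong) (auto simp: Dd einterval_def zero_ereal_def)
  finally show "prob {\<omega> \<in> space M. \<bar>Z \<omega>\<bar> \<le> W \<omega> * d (V \<omega> / W \<omega>)} =
      set_lebesgue_integral lborel {-tm..tm} (student_t_density m) +
      2 * (LBINT x=0..k. (LBINT w=0..\<infinity>. (Phi (w * d x) - Phi (w * tm)) * fV s g (x * w) * w * fW m w))" .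
  have int_U: "integrable M (\<lambda>\<omega>. W \<omega> * (D (V \<omega> / W \<omega>) - tm))"
  proof (rule Bochner_Integration.integrable_bound)
    show "integrable M (\<lambda>\<omega>. W \<omega> * (B + tm))" using int_W by simp
    show "AE \<omega> in M. norm (W \<omega> * (D (V \<omega> / W \<omega>) - tm)) \<le> norm (W \<omega> * (B + tm))"
    proof (intro AE_I2)
      fix \<omega>
      have "\<bar>D (V \<omega> / W \<omega>) - tm\<bar> \<le> \<bar>B + tm\<bar>" using B[of "V \<omega> / W \<omega>"] tm by linarith
      then show "norm (W \<omega> * (D (V \<omega> / W \<omega>) - tm)) \<le> norm (W \<omega> * (B + tm))"
        by (simp add: abs_mult mult_left_mono)
    qed
  qed measurable
  have "expectation (\<lambda>\<omega>. W \<omega> * d (V \<omega> / W \<omega>)) = expectation (\<lambda>\<omega>. tm * W \<omega> + W \<omega> * (D (V \<omega> / W \<omega>) - tm))"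
    by (intro Bochner_Integration.integral_cong) (auto simp: DVW algebra_simps)
  also have "\<dots> = tm * expectation W + expectation (\<lambda>\<omega>. (\<lambda>x w. w * (D x - tm)) (V \<omega> / W \<omega>) (W \<omega>))"
    using int_W int_U by (subst Bochner_Integration.integral_add) auto
  also have "expectation (\<lambda>\<omega>. (\<lambda>x w. w * (D x - tm)) (V \<omega> / W \<omega>) (W \<omega>))
    = (LBINT w=0..\<infinity>. (LBINT x=0..k. w * (D x - tm) * fV s g (x * w) * w * fW m w))"
    using int_U by (intro expectation_ratio(2)[OF dV dW indVW mf nn f0 _ _ k]) (auto simp: Dk)
  also have "\<dots> = (LBINT w=0..\<infinity>. (LBINT x=0..k. (d x - tm) * fV s g (x * w)) * w\<^sup>2 * fW m w)"
  proof -
    have "(LBINT x=0..k. w * (D x - tm) * fV s g (x * w) * w * fW m w) = (LBINT x=0..k. (d x - tm) * fV s g (x * w)) * w\<^sup>2 * fW m w" for w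
    proof -
      have "(LBINT x=0..k. w * (D x - tm) * fV s g (x * w) * w * fW m w) = (LBINT x=0..k. ((d x - tm) * fV s g (x * w)) * (w\<^sup>2 * fW m w))"
        using k by (intro interval_integral_cong) (auto simp: Dd einterval_def zero_ereal_def power2_eq_square)
      also have "\<dots> = (LBINT x=0..k. (d x - tm) * fV s g (x * w)) * (w\<^sup>2 * fW m w)"
        by (rule interval_lebesgue_integral_mult_left)
      finally show ?thesis by (simp add: mult.assoc)
    qed
    then show ?thesis by (simp only:)
  qed
  finally show "expectation (\<lambda>\<omega>. W \<omega> * d (V \<omega> / W \<omega>)) =
      tm * expectation W + (LBINT w=0..\<infinity>. (LBINT x=0..k. (d x - tm) * fV s g (x * w)) * w\<^sup>2 * fW m w)" .
qed

end

section \<open>Orthonormal coordinates adapted to the regression model\<close>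

lemma inner_transpose_matrix:
  fixes A :: "real^'m^'n"
  shows "x \<bullet> (transpose A *v y) = (A *v x) \<bullet> y"
  by (metis dot_lmul_matrix inner_commute transpose_matrix_vector transpose_transpose)

lemma orthonormal_Parseval:
  fixes B :: "'a::euclidean_space set"
  assumes "pairwise orthogonal B" "\<And>b. b \<in> B \<Longrightarrow> norm b = 1" "x \<in> span B"
  shows "x \<bullet> x = (\<Sum>b\<in>B. (b \<bullet> x)\<^sup>2)"
proof -
  have "x \<bullet> x = (\<Sum>b\<in>B. (b \<bullet> x) *\<^sub>R b) \<bullet> x"
    using orthonormal_expansion[OF assms] by simp
  then show ?thesis by (simp add: inner_sum_left power2_eq_square)
qed

text \<open>If \<open>c = 0\<close> there is no direction to follow and any unit vector of
  \<open>S\<close> serves; the equation \<open>c = norm c *\<^sub>R e\<close> still holds. Thus a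
  vanishing mean needs no separate case later.\<close>

lemma orthonormal_basis_through:
  fixes S :: "'a::euclidean_space set"
  assumes S: "subspace S" "S \<noteq> {0}" and c: "c \<in> S"
  obtains E e where "e \<in> E" "c = norm c *\<^sub>R e" "E \<subseteq> S" "pairwise orthogonal E"
    "\<And>x. x \<in> E \<Longrightarrow> norm x = 1" "span E = S"
proof -
  obtain y where y: "y \<in> S" "y \<noteq> 0" using S subspace_0[OF S(1)] by blast
  define e where "e = (if c = 0 then y /\<^sub>R norm y else c /\<^sub>R norm c)"
  have e: "e \<in> S" "norm e = 1" "c = norm c *\<^sub>R e"
    using y c S(1) by (auto simp: e_def subspace_scale)
  have ee: "e \<bullet> e = 1" using e(2) by (simp add: dot_square_norm)
  define T where "T = {x \<in> S. orthogonal e x}"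
  have "subspace T"
    using S(1) unfolding T_def by (auto simp: subspace_def orthogonal_def inner_add_right)
  then obtain B where B: "B \<subseteq> T" "pairwise orthogonal B" "\<And>x. x \<in> B \<Longrightarrow> norm x = 1" "span B = T"
    using orthonormal_basis_subspace by metis
  have "span (insert e B) = S"
  proof
    show "span (insert e B) \<subseteq> S"
      using B(1) e(1) S(1) by (intro span_minimal) (auto simp: T_def)
    show "S \<subseteq> span (insert e B)"
    proof
      fix x assume x: "x \<in> S"
      have "x - (e \<bullet> x) *\<^sub>R e \<in> T"
        using x e(1) S(1) ee
        by (auto simp: T_def orthogonal_def inner_diff_right intro: subspace_diff subspace_scale)
      then show "x \<in> span (insert e B)"
        using B(4) by (auto simp: span_breakdown_eq)
    qed
  qed
  moreover have "pairwise orthogonal (insert e B)"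
    using B(1,2) by (auto simp: pairwise_insert T_def orthogonal_commute)
  ultimately show thesis
    using e B by (intro that[of e "insert e B"]) (auto simp: T_def)
qed

lemma orthonormal_set_card:
  fixes E :: "'a::euclidean_space set"
  assumes "pairwise orthogonal E" "\<And>x. x \<in> E \<Longrightarrow> norm x = 1"
  shows "finite E" "card E = dim (span E)"
proof -
  have "0 \<notin> E" using assms(2) by (metis norm_zero zero_neq_one)
  then have "independent E"
    using assms(1) by (intro pairwise_orthogonal_independent)
  then show "finite E" "card E = dim (span E)"
    by (simp_all add: independent_imp_finite dim_eq_card_independent)
qed

text \<open>The set is completed by an orthonormal basis of its complement. The union has
  \<open>CARD('n)\<close> elements, so it can be indexed by \<open>'n\<close> itself, as an
  orthogonal matrix on the sample space requires.\<close>

lemma orthonormal_set_in_basis_family: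
  fixes E :: "(real^'n) set"
  assumes E: "pairwise orthogonal E" "\<And>x. x \<in> E \<Longrightarrow> norm x = 1"
  obtains h :: "'n \<Rightarrow> real^'n" where "inj h" "\<And>i. norm (h i) = 1"
    "\<And>i j. i \<noteq> j \<Longrightarrow> orthogonal (h i) (h j)" "E \<subseteq> range h"
proof -
  define T where "T = {y \<in> UNIV. \<forall>x \<in> span E. orthogonal x y}"
  have "subspace T"
    unfolding T_def by (auto simp: subspace_def orthogonal_def inner_add_right)
  then obtain B where B: "B \<subseteq> T" "pairwise orthogonal B" "\<And>x. x \<in> B \<Longrightarrow> norm x = 1" "span B = T"
    using orthonormal_basis_subspace by metis
  have dimT: "dim T + dim (span E) = CARD('n)"
    using dim_subspace_orthogonal_to_vectors[of "span E" UNIV] unfolding T_def by (simp add: dim_UNIV)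
  have EB: "orthogonal x y" if "x \<in> E" "y \<in> B" for x y
    using that B(1) by (auto simp: T_def span_base)
  have BE: "orthogonal x y" if "x \<in> B" "y \<in> E" for x y
    using EB[OF that(2,1)] by (simp add: orthogonal_commute)
  have on: "pairwise orthogonal (E \<union> B)"
    using E(1) B(2) EB BE by (auto simp: pairwise_def)
  have "E \<inter> B = {}"
  proof -
    have "x \<notin> B" if "x \<in> E" for x
      using EB[OF that, of x] E(2)[OF that] by (auto simp: orthogonal_self)
    then show ?thesis by blast
  qed
  then have "card (E \<union> B) = CARD('n)"
    using orthonormal_set_card[OF E] orthonormal_set_card[OF B(2,3)] dimT B(4)
    by (subst card_Un_disjoint) auto
  then obtain h where h: "bij_betw h (UNIV :: 'n set) (E \<union> B)"
    using orthonormal_set_card(1)[OF E] orthonormal_set_card(1)[OF B(2,3)]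
    by (metis finite_Un finite_class.finite_UNIV finite_same_card_bij)
  show thesis
  proof (rule that)
    show "inj h" using h by (simp add: bij_betw_def)
    have hi: "h i \<in> E \<union> B" for i using h by (auto simp: bij_betw_def)
    show "norm (h i) = 1" for i using hi[of i] E(2) B(3) by auto
    show "orthogonal (h i) (h j)" if "i \<noteq> j" for i j
      using on hi[of i] hi[of j] that \<open>inj h\<close> by (metis injD pairwise_def)
    show "E \<subseteq> range h" using h by (auto simp: bij_betw_def)
  qed
qed

context prob_space
begin

lemma indep_var_disjoint_functions:
  assumes ind: "indep_vars (\<lambda>_. borel) X I" and AB: "A \<inter> B = {}" "A \<subseteq> I" "B \<subseteq> I"
    and f: "f \<in> measurable (\<Pi>\<^sub>M i\<in>A. borel) N1" and g: "g \<in> measurable (\<Pi>\<^sub>M i\<in>B. borel) N2"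
  shows "indep_var N1 (\<lambda>\<omega>. f (\<lambda>i\<in>A. X i \<omega>)) N2 (\<lambda>\<omega>. g (\<lambda>i\<in>B. X i \<omega>))"
  using indep_var_compose[OF indep_var_restrict[OF ind AB] f g] by (simp add: comp_def)

text \<open>Bilinear expansion leaves the expectations of products of coordinates: the variance on
  the diagonal and, by independence and mean zero, 0 off it. The lemma translates covariance into
  geometry.\<close>

lemma covariance_iid_normal:
  fixes \<epsilon> :: "'a \<Rightarrow> real^'n"
  assumes ind: "indep_vars (\<lambda>_. borel) (\<lambda>i \<omega>. \<epsilon> \<omega> $ i) UNIV"
    and dist: "\<And>i. distributed M lborel (\<lambda>\<omega>. \<epsilon> \<omega> $ i) (\<lambda>x. ennreal (normal_density 0 \<sigma> x))"
    and \<sigma>: "\<sigma> > 0"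
  shows "expectation (\<lambda>\<omega>. (v \<bullet> \<epsilon> \<omega>) * (w \<bullet> \<epsilon> \<omega>)) = \<sigma>\<^sup>2 * (v \<bullet> w)"
proof -
  have sq: "has_bochner_integral M (\<lambda>\<omega>. (\<epsilon> \<omega> $ i) * (\<epsilon> \<omega> $ i)) (\<sigma>\<^sup>2)" for i
  proof -
    have "integrable lborel (\<lambda>x. normal_density 0 \<sigma> x * (x * x))"
      using integrable_normal_moment[OF \<sigma>, of 0 2] by (simp add: power2_eq_square)
    then have "integrable M (\<lambda>\<omega>. (\<epsilon> \<omega> $ i) * (\<epsilon> \<omega> $ i))"
      by (subst (asm) distributed_integrable[OF dist[of i]]) auto
    moreover have "variance (\<lambda>\<omega>. \<epsilon> \<omega> $ i) = \<sigma>\<^sup>2" "expectation (\<lambda>\<omega>. \<epsilon> \<omega> $ i) = 0"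
      using normal_distributed_variance[OF \<sigma> dist] normal_distributed_expectation[OF \<sigma> dist] by auto
    ultimately show ?thesis by (simp add: has_bochner_integral_iff power2_eq_square)
  qed
  have int1: "integrable M (\<lambda>\<omega>. \<epsilon> \<omega> $ i)" for i
  proof -
    have "integrable lborel (\<lambda>x. normal_density 0 \<sigma> x * x)"
      using integrable_normal_moment[OF \<sigma>, of 0 1] by simp
    then show ?thesis by (subst (asm) distributed_integrable[OF dist[of i]]) auto
  qed
  have pair: "has_bochner_integral M (\<lambda>\<omega>. (\<epsilon> \<omega> $ i) * (\<epsilon> \<omega> $ j)) (if i = j then \<sigma>\<^sup>2 else 0)" for i j
  proof (cases "i = j")
    case False
    have iv: "indep_var borel (\<lambda>\<omega>. \<epsilon> \<omega> $ i) borel (\<lambda>\<omega>. \<epsilon> \<omega> $ j)"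
      using indep_var_disjoint_functions[OF ind, of "{i}" "{j}" "\<lambda>f. f i" borel "\<lambda>f. f j" borel] False by simp
    show ?thesis
      using indep_var_lebesgue_integral[OF iv int1 int1] indep_var_integrable[OF iv int1 int1] False
        normal_distributed_expectation[OF \<sigma> dist]
      by (simp add: has_bochner_integral_iff)
  qed (use sq in simp)
  have "(\<lambda>\<omega>. (v \<bullet> \<epsilon> \<omega>) * (w \<bullet> \<epsilon> \<omega>)) = (\<lambda>\<omega>. \<Sum>i\<in>UNIV. \<Sum>j\<in>UNIV. (v $ i * w $ j) * ((\<epsilon> \<omega> $ i) * (\<epsilon> \<omega> $ j)))"
    by (auto simp: inner_vec_def sum_product mult_ac intro!: sum.cong)
  moreover have "has_bochner_integral M (\<lambda>\<omega>. \<Sum>i\<in>UNIV. \<Sum>j\<in>UNIV. (v $ i * w $ j) * ((\<epsilon> \<omega> $ i) * (\<epsilon> \<omega> $ j)))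
    (\<Sum>i\<in>UNIV. \<Sum>j\<in>UNIV. (v $ i * w $ j) * (if i = j then \<sigma>\<^sup>2 else 0))"
    by (intro has_bochner_integral_sum has_bochner_integral_mult_right pair)
  moreover have "(\<Sum>i\<in>UNIV. \<Sum>j\<in>UNIV. (v $ i * w $ j) * (if i = j then \<sigma>\<^sup>2 else 0)) = \<sigma>\<^sup>2 * (v \<bullet> w)"
    by (simp add: inner_vec_def sum_distrib_left if_distrib[of "(*) _"] mult_ac cong: if_cong)
  ultimately show ?thesis by (simp add: has_bochner_integral_iff)
qed

end

theorem theorem1:
  fixes M :: "'w measure"
    and X :: "real^'p^'n" and C :: "real^'s^'p"
    and a \<beta> :: "real^'p" and t :: "real^'s"
    and \<sigma> \<alpha> tm k :: real
    and \<epsilon> Y :: "'w \<Rightarrow> real^'n"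
    and d :: "real \<Rightarrow> real"
    and m s \<theta> v11 :: real and \<tau> \<gamma> :: "real^'s" and V22 :: "real^'s^'s"
    and betahat :: "'w \<Rightarrow> real^'p" and tauhat :: "'w \<Rightarrow> real^'s"
    and Sigmahat Thetahat F W :: "'w \<Rightarrow> real"
  assumes "prob_space M"
    and "CARD('n) > CARD('p)" and "rank X = CARD('p)"
    and "CARD('s) < CARD('p)" and "rank C = CARD('s)"
    and "a \<noteq> 0" and "a \<notin> span (columns C)"
    and "\<sigma> > 0"
    and "prob_space.indep_vars M (\<lambda>_. borel) (\<lambda>i \<omega>. \<epsilon> \<omega> $ i) UNIV"
    and "\<And>i. distributed M lborel (\<lambda>\<omega>. \<epsilon> \<omega> $ i) (\<lambda>x. ennreal (normal_density 0 \<sigma> x))"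
    and "\<And>\<omega>. Y \<omega> = X *v \<beta> + \<epsilon> \<omega>"
    and "0 < \<alpha>" and "\<alpha> < 1"
    and "tm > 0"
    and "set_lebesgue_integral lborel {-tm..tm}
           (student_t_density (real (CARD('n) - CARD('p)))) = 1 - \<alpha>"
    and "k > 0"
    and "continuous_on {0..} d" and "\<And>x. x \<ge> 0 \<Longrightarrow> d x > 0"
    and "\<And>x. x \<ge> k \<Longrightarrow> d x = tm"
  assumes "m = real (CARD('n) - CARD('p))"
    and "s = real CARD('s)"
    and "\<theta> = a \<bullet> \<beta>"
    and "\<tau> = transpose C *v \<beta> - t"
    and "betahat = (\<lambda>\<omega>. lse X (Y \<omega>))"
    and "Sigmahat = (\<lambda>\<omega>. sqrt ((norm (Y \<omega> - X *v betahat \<omega>))\<^sup>2 / m))"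
    and "Thetahat = (\<lambda>\<omega>. a \<bullet> betahat \<omega>)"
    and "tauhat = (\<lambda>\<omega>. transpose C *v betahat \<omega> - t)"
    and "v11 = a \<bullet> (matrix_inv (transpose X ** X) *v a)"
    and "V22 = transpose C ** matrix_inv (transpose X ** X) ** C"
    and "F = (\<lambda>\<omega>. (tauhat \<omega> \<bullet> (matrix_inv V22 *v tauhat \<omega>) / s) / (Sigmahat \<omega>)\<^sup>2)"
    and "\<gamma> = (1/\<sigma>) *\<^sub>R (matrix_inv (pd_sqrt V22) *v \<tau>)"
    and "W = (\<lambda>\<omega>. Sigmahat \<omega> / \<sigma>)"
  assumes "\<And>i. integral\<^sup>L M (\<lambda>\<omega>. (tauhat \<omega> $ i - \<tau> $ i) * (Thetahat \<omega> - \<theta>)) = 0"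
  shows
    "measure M {\<omega> \<in> space M.
        \<theta> \<in> {Thetahat \<omega> - sqrt v11 * Sigmahat \<omega> * d (sqrt (F \<omega>)) ..
               Thetahat \<omega> + sqrt v11 * Sigmahat \<omega> * d (sqrt (F \<omega>))}}
       = 1 - \<alpha> + 2 * (LBINT x=0..k. (LBINT w=0..\<infinity>.
             (Phi (w * d x) - Phi (w * tm)) * fV s (norm \<gamma>) (x * w) * w * fW m w))
     \<and>
     integral\<^sup>L M (\<lambda>\<omega>. 2 * sqrt v11 * Sigmahat \<omega> * d (sqrt (F \<omega>)))
       / integral\<^sup>L M (\<lambda>\<omega>. 2 * tm * sqrt v11 * Sigmahat \<omega>)
       = 1 + 1 / (tm * integral\<^sup>L M W) *
           (LBINT w=0..\<infinity>. (LBINT x=0..k. (d x - tm) * fV s (norm \<gamma>) (x * w)) * w\<^sup>2 * fW m w)"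
proof -
  interpret prob_space M by (rule assms(1))
  \<comment> \<open>This rule would rewrite products with a transpose into \<open>v*\<close> form
    and hide the pattern of \<open>inner_transpose_matrix\<close>.\<close>
  note [simp del] = transpose_matrix_vector
  note \<sigma> = assms(8) and ind = assms(9) and dist = assms(10) and Y = assms(11) and m = assms(20) and s = assms(21)
  have m0: "m > 0" and s0: "s > 0" using assms(2) by (simp_all add: m s)
  have injX: "inj ((*v) X)" using assms(3) by (simp add: full_rank_injective)
  have injC: "inj ((*v) C)" using assms(5) by (simp add: full_rank_injective)

  \<comment> \<open>The Gram matrix of the design and its inverse\<close>
  define A where "A = transpose X ** X"
  define G where "G = matrix_inv A"
  have Av: "A *v z = transpose X *v (X *v z)" for z
    by (simp add: A_def matrix_vector_mul_assoc)
  have ipA: "z \<bullet> (A *v y) = (X *v z) \<bullet> (X *v y)" for z y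
    by (simp add: Av inner_transpose_matrix)
  have Apd: "z \<bullet> (A *v z) > 0" if "z \<noteq> 0" for z
  proof -
    have "X *v z \<noteq> 0" using that injX injD[of "(*v) X" z 0] by auto
    then show ?thesis by (simp add: ipA)
  qed
  have invA: "invertible A" using Apd by (rule pd_matrix_invertible)
  have AG: "A *v (G *v z) = z" for z
    by (simp add: G_def matrix_inv_vector_cancel[OF invA])
  have GA: "G *v (A *v z) = z" for z
    by (simp add: G_def matrix_inv_vector_cancel[OF invA])
  \<comment> \<open>The form of \<open>G\<close> is an inner product of vectors in the column space
    of \<open>X\<close>; its symmetry is thereby visible without transposing an inverse.\<close>
  have ipG: "z \<bullet> (G *v y) = (X *v (G *v z)) \<bullet> (X *v (G *v y))" for z y
    using ipA[of "G *v z" "G *v y"] ipA[of "G *v y" "G *v z"] by (simp add: AG inner_commute)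
  have ipGX: "z \<bullet> (G *v (transpose X *v e)) = (X *v (G *v z)) \<bullet> e" for z e
    using ipG[of z "transpose X *v e"] ipG[of "transpose X *v e" z]
    by (simp add: inner_commute[of _ "G *v z"] inner_commute[of "X *v (G *v (transpose X *v e))"])
       (simp add: inner_transpose_matrix inner_commute[of "transpose X *v e"])

  \<comment> \<open>The map \<open>L\<close> (P C in the overview) and the vector \<open>u\<close>
    (P a)\<close>
  define L where "L z = X *v (G *v (C *v z))" for z
  have linL: "linear L"
    unfolding L_def by (intro linearI) (simp_all add: matrix_vector_right_distrib matrix_vector_mult_scaleR)
  have injL: "inj L"
  proof (rule injI)
    fix x y assume "L x = L y"
    then have "G *v (C *v x) = G *v (C *v y)" using injX by (simp add: L_def inj_eq)
    then have "C *v x = C *v y" by (metis AG)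
    then show "x = y" using injC by (simp add: inj_eq)
  qed
  define u where "u = X *v (G *v a)"
  have u0: "u \<noteq> 0"
  proof
    assume "u = 0"
    then have "G *v a = 0" using injX injD[of "(*v) X" "G *v a" 0] by (simp add: u_def)
    then have "a = 0" using AG[of a] by simp
    then show False using assms(6) by simp
  qed
  have v11: "v11 = (norm u)\<^sup>2"
    using ipG[of a a] by (simp add: assms(28) u_def dot_square_norm A_def[symmetric] G_def[symmetric])
  have sv: "sqrt v11 = norm u" by (simp add: v11)

  \<comment> \<open>Estimation errors as linear forms in the noise\<close>
  have bh: "betahat \<omega> = \<beta> + G *v (transpose X *v \<epsilon> \<omega>)" for \<omega>
  proof -
    have "betahat \<omega> = G *v (transpose X *v (X *v \<beta> + \<epsilon> \<omega>))"
      by (simp add: assms(24) lse_def Y A_def[symmetric] G_def[symmetric])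
    also have "\<dots> = G *v (A *v \<beta>) + G *v (transpose X *v \<epsilon> \<omega>)"
      by (simp add: Av matrix_vector_right_distrib)
    finally show ?thesis by (simp add: GA)
  qed
  have Th: "Thetahat \<omega> - \<theta> = u \<bullet> \<epsilon> \<omega>" for \<omega>
    by (simp add: assms(26,22) bh inner_add_right ipGX u_def)
  have th: "z \<bullet> (tauhat \<omega> - \<tau>) = L z \<bullet> \<epsilon> \<omega>" for z \<omega>
  proof -
    have "z \<bullet> (tauhat \<omega> - \<tau>) = z \<bullet> (transpose C *v (G *v (transpose X *v \<epsilon> \<omega>)))"
      by (simp add: assms(27,23) bh matrix_vector_right_distrib)
    then show ?thesis by (simp add: inner_transpose_matrix ipGX L_def)
  qed

  \<comment> \<open>Zero covariance as orthogonality\<close>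
  have Lu: "L z \<bullet> u = 0" for z
  proof -
    have 1: "L (axis i 1) \<bullet> u = 0" for i
    proof -
      \<comment> \<open>Tested against an axis vector, the error of \<open>tauhat\<close> is its
        \<open>i\<close>-th component, so the covariance hypothesis concerns precisely these two
        linear forms.\<close>
      have "0 = expectation (\<lambda>\<omega>. (L (axis i 1) \<bullet> \<epsilon> \<omega>) * (u \<bullet> \<epsilon> \<omega>))"
        using assms(33)[of i] by (simp add: th[symmetric] Th[symmetric] inner_axis' )
      also have "\<dots> = \<sigma>\<^sup>2 * (L (axis i 1) \<bullet> u)"
        by (rule covariance_iid_normal[OF ind dist \<sigma>])
      finally show ?thesis using \<sigma> by simp
    qed
    have "z = (\<Sum>i\<in>UNIV. z $ i *\<^sub>R axis i 1)"
      using basis_expansion[of z] by (simp add: scalar_mult_eq_scaleR)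
    then have "L z = (\<Sum>i\<in>UNIV. z $ i *\<^sub>R L (axis i 1))"
      by (metis (no_types, lifting) linear_sum[OF linL] linear_cmul[OF linL] sum.cong)
    then show ?thesis by (simp add: inner_sum_left 1)
  qed

  \<comment> \<open>The matrix \<open>V22\<close> and the noncentrality\<close>
  have ipV: "z \<bullet> (V22 *v y) = L z \<bullet> L y" for z y
  proof -
    have "V22 *v y = transpose C *v (G *v (C *v y))"
      by (simp add: assms(29) A_def[symmetric] G_def[symmetric] matrix_vector_mul_assoc matrix_mul_assoc)
    then show ?thesis by (simp add: inner_transpose_matrix ipG L_def)
  qed
  have Vsym: "transpose V22 = V22"
  proof -
    have "transpose V22 *v y = V22 *v y" for y
      by (rule vector_eq_ldot[THEN iffD1]) (simp add: inner_transpose_matrix ipV inner_commute[of "V22 *v _"] inner_commute)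
    then show ?thesis by (simp add: matrix_eq)
  qed
  have Vpd: "z \<bullet> (V22 *v z) > 0" if "z \<noteq> 0" for z
  proof -
    have "L z \<noteq> 0" using that injL linear_0[OF linL] by (metis injD)
    then show ?thesis by (simp add: ipV)
  qed
  have invV: "invertible V22" using Vpd by (rule pd_matrix_invertible)
  note VV = matrix_inv_vector_cancel[OF invV]

  \<comment> \<open>\<open>c\<close> represents the mean inside the range of \<open>L\<close>: its
    inner product with \<open>L z\<close> is \<open>z \<bullet> \<tau>\<close>. Hence
    \<open>c + \<epsilon> \<omega>\<close> has the same inner products with that range as
    \<open>tauhat\<close> prescribes.\<close>
  define c where "c = L (matrix_inv V22 *v \<tau>)"
  have Lc: "L z \<bullet> c = z \<bullet> \<tau>" for z
    using ipV[of z "matrix_inv V22 *v \<tau>"] by (simp add: c_def VV)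
  define g where "g = norm \<gamma>"
  have g: "g = norm c / \<sigma>"
  proof -
    have "(norm (matrix_inv (pd_sqrt V22) *v \<tau>))\<^sup>2 = \<tau> \<bullet> (matrix_inv V22 *v \<tau>)"
      by (rule norm_inverse_pd_sqrt[OF Vsym Vpd])
    also have "\<dots> = (norm c)\<^sup>2"
      using Lc[of "matrix_inv V22 *v \<tau>"] by (simp add: c_def[symmetric] inner_commute dot_square_norm)
    finally have "norm (matrix_inv (pd_sqrt V22) *v \<tau>) = norm c" by simp
    then show ?thesis using \<sigma> by (simp add: g_def assms(31))
  qed

  \<comment> \<open>An orthonormal basis adapted to the two errors and the residual\<close>
  have subL: "subspace (range L)" using linL by (intro linear_subspace_image) auto
  have dimL: "dim (range L) = CARD('s)"
    using dim_image_eq[OF linL, of UNIV] injL by (simp add: dim_UNIV)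
  have nzL: "range L \<noteq> {0}"
  proof
    assume "range L = {0}"
    then show False using dimL dim_eq_0[of "range L"] by simp
  qed
  have cL: "c \<in> range L" by (simp add: c_def)
  obtain E2 e0 where E2: "e0 \<in> E2" "c = norm c *\<^sub>R e0" "E2 \<subseteq> range L" "pairwise orthogonal E2"
    "\<And>x. x \<in> E2 \<Longrightarrow> norm x = 1" "span E2 = range L"
    using orthonormal_basis_through[OF subL nzL cL] by metis
  define T where "T = {y \<in> UNIV. \<forall>x\<in>range ((*v) X). orthogonal x y}"
  have "subspace T"
    unfolding T_def by (auto simp: subspace_def orthogonal_def inner_add_right)
  then obtain E4 where E4: "E4 \<subseteq> T" "pairwise orthogonal E4" "\<And>x. x \<in> E4 \<Longrightarrow> norm x = 1" "span E4 = T"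
    using orthonormal_basis_subspace by metis
  have dimT: "dim T + CARD('p) = CARD('n)"
    using dim_subspace_orthogonal_to_vectors[of "range ((*v) X)" UNIV] assms(3)
    unfolding T_def rank_dim_range by (simp add: dim_UNIV linear_subspace_image)
  have card2: "finite E2" "card E2 = CARD('s)"
    using orthonormal_set_card[OF E2(4,5)] E2(6) dimL by simp_all
  have card4: "finite E4" "real (card E4) = m"
    using orthonormal_set_card[OF E4(2,3)] E4(4) dimT by (simp_all add: m)
  define e1 where "e1 = u /\<^sub>R norm u"
  have e1: "norm e1 = 1" "u = norm u *\<^sub>R e1" using u0 by (simp_all add: e1_def)
  have o12: "orthogonal e1 x" if "x \<in> E2" for x
    using that E2(3) Lu by (auto simp: e1_def orthogonal_def inner_commute)
  have o14: "orthogonal e1 x" if "x \<in> E4" for x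
    using that E4(1) by (auto simp: e1_def u_def T_def orthogonal_def)
  have o24: "orthogonal x y" if "x \<in> E2" "y \<in> E4" for x y
    using that E2(3) E4(1) by (auto simp: T_def L_def orthogonal_def)
  have n12: "e1 \<notin> E2" and n14: "e1 \<notin> E4"
    using o12[of e1] o14[of e1] e1(1) by (auto simp: orthogonal_self)
  have n24: "x \<notin> E4" if "x \<in> E2" for x
    using o24[OF that, of x] E2(5)[OF that] by (auto simp: orthogonal_self)
  have on: "pairwise orthogonal (insert e1 (E2 \<union> E4))"
    using E2(4) E4(2) o12 o14 o24 unfolding pairwise_def
    by (metis (no_types, lifting) Un_iff insert_iff orthogonal_commute)
  have on1: "norm x = 1" if "x \<in> insert e1 (E2 \<union> E4)" for x
    using that e1(1) E2(5) E4(3) by auto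
  obtain h :: "'n \<Rightarrow> real^'n" where h: "inj h" "\<And>i. norm (h i) = 1"
    "\<And>i j. i \<noteq> j \<Longrightarrow> orthogonal (h i) (h j)" "insert e1 (E2 \<union> E4) \<subseteq> range h"
    using orthonormal_set_in_basis_family[OF on on1] by blast

  \<comment> \<open>Standard normal coordinates and independent sums of squares\<close>
  define \<xi> where "\<xi> i \<omega> = (h i \<bullet> \<epsilon> \<omega>) / \<sigma>" for i \<omega>
  have ind\<xi>: "indep_vars (\<lambda>_. borel) \<xi> UNIV"
    unfolding \<xi>_def
    by (rule indep_vars_compose2[OF iid_normal_orthonormal_coordinates(1)[where h = h, OF ind dist h(2,3)]]) measurable
  have dist\<xi>: "distributed M lborel (\<xi> i) (\<lambda>x. ennreal (std_normal_density x))" for i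
    using iid_normal_orthonormal_coordinates(2)[where h = h and i = i, OF ind dist h(2,3)]
      normal_standard_normal_convert[OF \<sigma>, of "\<lambda>\<omega>. h i \<bullet> \<epsilon> \<omega>" 0]
    by (simp add: \<xi>_def[abs_def])
  obtain i1 where i1: "h i1 = e1" using h(4) by auto
  obtain j0 where j0: "h j0 = e0" using h(4) E2(1) by auto
  \<comment> \<open>The index of \<open>e0\<close> is left out because its coordinate alone carries
    the shift \<open>g\<close>.\<close>
  define I2 where "I2 = h -` (E2 - {e0})"
  define I4 where "I4 = h -` E4"
  have img2: "h ` I2 = E2 - {e0}" and img4: "h ` I4 = E4" and img02: "h ` insert j0 I2 = E2"
    using h(4) j0 E2(1) by (auto simp: I2_def I4_def)
  have injh: "inj_on h K" for K using h(1) by (rule inj_on_subset) simp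
  have cI2: "1 + real (card I2) = s"
    using card_image[OF injh[of I2]] card_Suc_Diff1[OF card2(1) E2(1)] card2(2) by (simp add: img2 s)
  have cI4: "real (card I4) = m"
    using card_image[OF injh[of I4]] card4 by (simp add: img4)
  \<comment> \<open>The law of a sum of squares is stated with a distinguished index. Any
    \<open>i4\<close> will do here, with shift 0, which makes the law central.\<close>
  have "I4 \<noteq> {}" using cI4 m0 by auto
  then obtain i4 where i4: "i4 \<in> I4" by blast
  have j0I2: "j0 \<notin> I2" by (simp add: I2_def j0)
  define Q where "Q \<omega> = (\<xi> j0 \<omega> + g)\<^sup>2 + (\<Sum>i\<in>I2. (\<xi> i \<omega>)\<^sup>2)" for \<omega>
  define R where "R \<omega> = (\<Sum>i\<in>I4. (\<xi> i \<omega>)\<^sup>2)" for \<omega>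
  have dQ: "distributed M lborel Q (\<lambda>x. ennreal (ncchi2_density s (g\<^sup>2) x))"
    unfolding Q_def cI2[symmetric]
    by (rule distributed_sum_squares_std_normal[OF _ j0I2 indep_vars_subset[OF ind\<xi>] dist\<xi>]) auto
  have dR: "distributed M lborel R (\<lambda>x. ennreal (chi2_density m x))"
  proof -
    have "distributed M lborel (\<lambda>\<omega>. (\<xi> i4 \<omega> + 0)\<^sup>2 + (\<Sum>i\<in>I4 - {i4}. (\<xi> i \<omega>)\<^sup>2))
      (\<lambda>x. ennreal (ncchi2_density (1 + real (card (I4 - {i4}))) (0\<^sup>2) x))"
      by (rule distributed_sum_squares_std_normal[OF _ _ indep_vars_subset[OF ind\<xi>] dist\<xi>]) auto
    moreover have "1 + real (card (I4 - {i4})) = m"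
      using card_Suc_Diff1[of I4 i4] i4 cI4 by simp
    moreover have "(\<lambda>\<omega>. (\<xi> i4 \<omega> + 0)\<^sup>2 + (\<Sum>i\<in>I4 - {i4}. (\<xi> i \<omega>)\<^sup>2)) = R"
      using i4 by (auto simp: R_def sum.remove)
    ultimately show ?thesis by (simp add: ncchi2_density_0)
  qed
  have Q0: "Q \<omega> \<ge> 0" and R0: "R \<omega> \<ge> 0" for \<omega>
    by (simp_all add: Q_def R_def sum_nonneg)
  have disj: "insert j0 I2 \<inter> I4 = {}" "{i1} \<inter> (insert j0 I2 \<union> I4) = {}"
    using n12 n14 n24 E2(1) i1 j0 by (auto simp: I2_def I4_def)
  have indQR: "indep_var borel Q borel R"
  proof -
    have "indep_var borel (\<lambda>\<omega>. (\<lambda>f. (f j0 + g)\<^sup>2 + (\<Sum>i\<in>I2. (f i)\<^sup>2)) (\<lambda>i\<in>insert j0 I2. \<xi> i \<omega>))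
      borel (\<lambda>\<omega>. (\<lambda>f. \<Sum>i\<in>I4. (f i)\<^sup>2) (\<lambda>i\<in>I4. \<xi> i \<omega>))"
      by (rule indep_var_disjoint_functions[OF ind\<xi> disj(1)]) measurable
    then show ?thesis by (simp add: Q_def[abs_def] R_def[abs_def])
  qed
  have indZ: "indep_var borel (\<xi> i1) borel (\<lambda>\<omega>. f (Q \<omega>, R \<omega>))"
    if f[measurable]: "f \<in> borel_measurable (borel \<Otimes>\<^sub>M borel)" for f :: "real \<times> real \<Rightarrow> real"
  proof -
    have "indep_var borel (\<lambda>\<omega>. (\<lambda>f. f i1) (\<lambda>i\<in>{i1}. \<xi> i \<omega>))
      borel (\<lambda>\<omega>. (\<lambda>p. f ((p j0 + g)\<^sup>2 + (\<Sum>i\<in>I2. (p i)\<^sup>2), \<Sum>i\<in>I4. (p i)\<^sup>2)) (\<lambda>i\<in>insert j0 I2 \<union> I4. \<xi> i \<omega>))"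
      by (rule indep_var_disjoint_functions[OF ind\<xi> disj(2)]) measurable
    then show ?thesis by (simp add: Q_def[abs_def] R_def[abs_def])
  qed

  \<comment> \<open>The statistics expressed in the new coordinates\<close>
  have Qeq: "tauhat \<omega> \<bullet> (matrix_inv V22 *v tauhat \<omega>) = \<sigma>\<^sup>2 * Q \<omega>" for \<omega>
  proof -
    \<comment> \<open>\<open>L \<zeta>\<close> is the orthogonal projection of \<open>y\<close> onto
      the range of \<open>L\<close>, so the quadratic form is a squared projection length and
      Parseval in \<open>E2\<close> applies.\<close>
    define \<zeta> where "\<zeta> = matrix_inv V22 *v tauhat \<omega>"
    define y where "y = c + \<epsilon> \<omega>"
    have ty: "z \<bullet> tauhat \<omega> = L z \<bullet> y" for z
      using th[of z \<omega>] Lc[of z] by (simp add: y_def inner_add_right inner_diff_right)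
    have Lz: "L z \<bullet> L \<zeta> = L z \<bullet> y" for z
      using ipV[of z \<zeta>] ty[of z] by (simp add: \<zeta>_def VV)
    have "tauhat \<omega> \<bullet> (matrix_inv V22 *v tauhat \<omega>) = L \<zeta> \<bullet> L \<zeta>"
      using Lz[of \<zeta>] ty[of \<zeta>] by (simp add: \<zeta>_def[symmetric] inner_commute)
    also have "\<dots> = (\<Sum>e\<in>E2. (e \<bullet> L \<zeta>)\<^sup>2)"
    proof (rule orthonormal_Parseval[OF E2(4,5)])
      show "L \<zeta> \<in> span E2" unfolding E2(6) by (rule rangeI)
    qed
    also have "\<dots> = (\<Sum>e\<in>E2. (e \<bullet> y)\<^sup>2)"
      using E2(3) Lz by (intro sum.cong) auto
    also have "\<dots> = (\<Sum>i\<in>insert j0 I2. (h i \<bullet> y)\<^sup>2)"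
      unfolding img02[symmetric] by (subst sum.reindex[OF injh]) (simp only: comp_def)
    also have "\<dots> = (h j0 \<bullet> y)\<^sup>2 + (\<Sum>i\<in>I2. (h i \<bullet> y)\<^sup>2)"
      using j0I2 by simp
    also have "h j0 \<bullet> y = \<sigma> * (\<xi> j0 \<omega> + g)"
    proof -
      have "e0 \<bullet> c = norm c" using E2(2) E2(5)[OF E2(1)]
        by (metis dot_square_norm inner_scaleR_right mult.right_neutral power_one)
      then show ?thesis using \<sigma> by (simp add: y_def j0 inner_add_right \<xi>_def g field_simps)
    qed
    also have "(\<Sum>i\<in>I2. (h i \<bullet> y)\<^sup>2) = (\<Sum>i\<in>I2. (\<sigma> * \<xi> i \<omega>)\<^sup>2)"
    proof (rule sum.cong[OF refl])
      fix i assume "i \<in> I2"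
      then have "i \<noteq> j0" using j0I2 by auto
      then have "h i \<bullet> e0 = 0" using h(3)[of i j0] by (simp add: j0 orthogonal_def)
      then have "h i \<bullet> c = 0" using E2(2) by (metis inner_scaleR_right mult_zero_right)
      then show "(h i \<bullet> y)\<^sup>2 = (\<sigma> * \<xi> i \<omega>)\<^sup>2" using \<sigma> by (simp add: y_def inner_add_right \<xi>_def)
    qed
    finally show ?thesis
      by (simp only: Q_def power_mult_distrib distrib_left[of "\<sigma>\<^sup>2"] sum_distrib_left)
  qed
  have Req: "(norm (Y \<omega> - X *v betahat \<omega>))\<^sup>2 = \<sigma>\<^sup>2 * R \<omega>" for \<omega>
  proof -
    define r where "r = Y \<omega> - X *v betahat \<omega>"
    \<comment> \<open>These are the normal equations; they put the residual into the span of
      \<open>E4\<close>, where its coordinates agree with those of the noise.\<close>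
    have "(X *v x) \<bullet> r = 0" for x
    proof -
      have "(X *v x) \<bullet> r = x \<bullet> (transpose X *v r)" by (simp add: inner_transpose_matrix)
      also have "transpose X *v r = transpose X *v \<epsilon> \<omega> - A *v (G *v (transpose X *v \<epsilon> \<omega>))"
        by (simp add: r_def Y bh Av matrix_vector_right_distrib matrix_vector_mult_diff_distrib)
      also have "\<dots> = 0" by (simp add: AG)
      finally show ?thesis by simp
    qed
    then have rT: "r \<in> span E4" by (auto simp: E4(4) T_def orthogonal_def)
    have er: "e \<bullet> r = e \<bullet> \<epsilon> \<omega>" if "e \<in> E4" for e
    proof -
      have "e \<bullet> (X *v x) = 0" for x
        using that E4(1) by (auto simp: T_def orthogonal_def inner_commute)
      then show ?thesis by (simp add: r_def Y inner_diff_right inner_add_right)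
    qed
    have "(norm r)\<^sup>2 = (\<Sum>e\<in>E4. (e \<bullet> r)\<^sup>2)"
      using orthonormal_Parseval[OF E4(2,3) rT] by (simp add: dot_square_norm)
    also have "\<dots> = (\<Sum>e\<in>E4. (e \<bullet> \<epsilon> \<omega>)\<^sup>2)" by (simp add: er)
    also have "\<dots> = (\<Sum>i\<in>I4. (h i \<bullet> \<epsilon> \<omega>)\<^sup>2)"
      unfolding img4[symmetric] by (subst sum.reindex[OF injh]) (simp only: comp_def)
    also have "\<dots> = \<sigma>\<^sup>2 * R \<omega>"
      using \<sigma> by (simp add: R_def sum_distrib_left \<xi>_def power_divide)
    finally show ?thesis by (simp add: r_def)
  qed
  have Weq: "W = (\<lambda>\<omega>. sqrt (R \<omega> / m))"
    using \<sigma> by (simp add: assms(32,25) Req real_sqrt_mult real_sqrt_divide)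
  have Sig: "Sigmahat \<omega> = \<sigma> * W \<omega>" for \<omega>
    using \<sigma> by (simp add: assms(32))
  have W0: "W \<omega> \<ge> 0" for \<omega> using R0[of \<omega>] m0 by (simp add: Weq)
  \<comment> \<open>The scale \<open>\<sigma>\<close> cancels. If \<open>W \<omega> = 0\<close>,
    both sides are 0.\<close>
  have Feq: "sqrt (F \<omega>) = sqrt (Q \<omega> / s) / W \<omega>" for \<omega>
  proof -
    have "F \<omega> = (Q \<omega> / s) / (W \<omega>)\<^sup>2"
      using \<sigma> by (simp add: assms(30) Qeq Sig power_mult_distrib)
    then show ?thesis using W0[of \<omega>] by (simp add: real_sqrt_divide real_sqrt_mult)
  qed

  \<comment> \<open>Coverage and scaled expected length\<close>
  note core = coverage_and_expected_length[OF dist\<xi> dQ Q0 dR R0 s0 m0 indQR indZ assms(17,18,19,16,14)]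
  have coverage: "prob {\<omega> \<in> space M. \<bar>\<xi> i1 \<omega>\<bar> \<le> W \<omega> * d (sqrt (Q \<omega> / s) / W \<omega>)} =
      set_lebesgue_integral lborel {-tm..tm} (student_t_density m) +
      2 * (LBINT x=0..k. (LBINT w=0..\<infinity>. (Phi (w * d x) - Phi (w * tm)) * fV s g (x * w) * w * fW m w))"
    unfolding Weq by (rule core(1))
  have len: "expectation (\<lambda>\<omega>. W \<omega> * d (sqrt (Q \<omega> / s) / W \<omega>)) =
      tm * expectation W + (LBINT w=0..\<infinity>. (LBINT x=0..k. (d x - tm) * fV s g (x * w)) * w\<^sup>2 * fW m w)"
    unfolding Weq by (rule core(2))
  have EW: "expectation W > 0"
    unfolding Weq by (rule core(3))
  have "{\<omega> \<in> space M. \<theta> \<in> {Thetahat \<omega> - sqrt v11 * Sigmahat \<omega> * d (sqrt (F \<omega>))..Thetahat \<omega> + sqrt v11 * Sigmahat \<omega> * d (sqrt (F \<omega>))}}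
    = {\<omega> \<in> space M. \<bar>\<xi> i1 \<omega>\<bar> \<le> W \<omega> * d (sqrt (Q \<omega> / s) / W \<omega>)}"
  proof (intro Collect_cong conj_cong refl)
    fix \<omega>
    \<comment> \<open>The error and the half-length share the positive factor
      \<open>norm u * \<sigma>\<close>; cancelling it removes all parameters except those entering
      through \<open>g\<close>.\<close>
    have nu: "norm u * \<sigma> > 0" using u0 \<sigma> by simp
    have "Thetahat \<omega> - \<theta> = (norm u * \<sigma>) * \<xi> i1 \<omega>"
      using \<sigma> e1(2) by (simp add: Th \<xi>_def i1) (metis inner_scaleR_left)
    then have "\<bar>Thetahat \<omega> - \<theta>\<bar> = (norm u * \<sigma>) * \<bar>\<xi> i1 \<omega>\<bar>"
      using \<sigma> by (simp add: abs_mult)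
    moreover have "sqrt v11 * Sigmahat \<omega> * d (sqrt (F \<omega>)) = (norm u * \<sigma>) * (W \<omega> * d (sqrt (Q \<omega> / s) / W \<omega>))"
      by (simp add: sv Sig Feq)
    moreover have "\<theta> \<in> {Thetahat \<omega> - b..Thetahat \<omega> + b} \<longleftrightarrow> \<bar>Thetahat \<omega> - \<theta>\<bar> \<le> b" for b
      by auto
    ultimately show "\<theta> \<in> {Thetahat \<omega> - sqrt v11 * Sigmahat \<omega> * d (sqrt (F \<omega>))..Thetahat \<omega> + sqrt v11 * Sigmahat \<omega> * d (sqrt (F \<omega>))}
      \<longleftrightarrow> \<bar>\<xi> i1 \<omega>\<bar> \<le> W \<omega> * d (sqrt (Q \<omega> / s) / W \<omega>)"
      using nu by (simp only: mult_le_cancel_left_pos)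
  qed
  then have a: "measure M {\<omega> \<in> space M. \<theta> \<in> {Thetahat \<omega> - sqrt v11 * Sigmahat \<omega> * d (sqrt (F \<omega>))..Thetahat \<omega> + sqrt v11 * Sigmahat \<omega> * d (sqrt (F \<omega>))}}
    = 1 - \<alpha> + 2 * (LBINT x=0..k. (LBINT w=0..\<infinity>. (Phi (w * d x) - Phi (w * tm)) * fV s (norm \<gamma>) (x * w) * w * fW m w))"
    using coverage assms(15) by (simp only: g_def m)
  \<comment> \<open>The same factor, doubled, is common to both expected lengths and drops out of
    their quotient.\<close>
  have num: "integral\<^sup>L M (\<lambda>\<omega>. 2 * sqrt v11 * Sigmahat \<omega> * d (sqrt (F \<omega>)))
    = 2 * norm u * \<sigma> * integral\<^sup>L M (\<lambda>\<omega>. W \<omega> * d (sqrt (Q \<omega> / s) / W \<omega>))"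
    by (simp add: sv Sig Feq mult.assoc)
  have den: "integral\<^sup>L M (\<lambda>\<omega>. 2 * tm * sqrt v11 * Sigmahat \<omega>) = 2 * norm u * \<sigma> * (tm * integral\<^sup>L M W)"
    by (simp add: sv Sig mult_ac)
  have "integral\<^sup>L M (\<lambda>\<omega>. 2 * sqrt v11 * Sigmahat \<omega> * d (sqrt (F \<omega>))) / integral\<^sup>L M (\<lambda>\<omega>. 2 * tm * sqrt v11 * Sigmahat \<omega>)
    = integral\<^sup>L M (\<lambda>\<omega>. W \<omega> * d (sqrt (Q \<omega> / s) / W \<omega>)) / (tm * integral\<^sup>L M W)"
    unfolding num den using u0 \<sigma> by simp
  also have "\<dots> = 1 + 1 / (tm * integral\<^sup>L M W) *
    (LBINT w=0..\<infinity>. (LBINT x=0..k. (d x - tm) * fV s (norm \<gamma>) (x * w)) * w\<^sup>2 * fW m w)"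
    unfolding len using EW assms(14) by (simp add: g_def add_divide_distrib)
  finally show ?thesis using a by blast
qed

end
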